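(* Assume the standing setting below with $h\in R_{k-1}$ for some $k>1$. Let $a_n\to\infty$, let $t_n$ solve $m(t_n)=a_n$, and assume: (i) $\lim_{n\to\infty}\psi(t_n)^2/\sqrt{n\psi'(t_n)}=0$; (ii) for some $\delta>0$, $\liminf_{n\to\infty}\log g(a_n)/\log n>\delta$; (iii) $\epsilon_n>0$ is a sequence with $\lim_{n\to\infty} n\log a_n/(a_n^{k-2}\epsilon_n^2)=0$. Let $P_{A_n}$ denote the conditional distribution of $X_1$ given $A_n:=(S_1^n\ge na_n)$ and $G_{a_n}=\Pi^{a_n}$ the tilted distribution at point $a_n$. Then for every sequence of Borel sets $B_n\subset\mathbb R$ with $\liminf_{n\to\infty}P_{A_n}(B_n)>0$, $$P_{A_n}(B_n)=(1+o(1))\,G_{a_n}(B_n)\quad(n\to\infty).$$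
   Context: Standing setting. $X_1,X_2,\dots$ are i.i.d. nonnegative real random variables with a uniformly bounded density $p$ (w.r.t. Lebesgue measure) of the form $p(x)=c\exp(-(g(x)-q(x)))$ for $x\ge 0$, where $c>0$ is a normalizing constant, $g$ is positive and differentiable with $g(x)/x\to\infty$ as $x\to\infty$, $h:=g'$, and for some $\vartheta>0$ and all large $x$, $\sup_{|v-x|<\vartheta x}|q(v)|\le 1/\sqrt{x h(x)}$. $R_0$ is the class of functions $l(x)=\exp\big(\int_1^x \epsilon(u)/u\,du\big)$, $x\ge 1$, with $\epsilon$ twice differentiable and $\epsilon(x)\to 0$ as $x\to\infty$. For $\beta>0$, $h\in R_\beta$ if for large $x$, $h(x)=x^\beta l(x)$ with $l\in R_0$ whose function $\epsilon$ satisfies $\limsup_{x\to\infty} x|\epsilon'(x)|<\infty$ and $\limsup_{x\to\infty}x^2|\epsilon''(x)|<\infty$. $\psi(u):=\inf\{x:h(x)\ge u\}$. Let $\phi(t)=E e^{tX_1}$, $m(t)=\frac{d}{dt}\log\phi(t)$, $s^2(t)=\frac{d^2}{dt^2}\log\phi(t)$. For $a$ in the range of $m$, the tilted density at point $a$ is $\pi^a(x)=e^{tx}p(x)/\phi(t)$ where $t$ solves $m(t)=a$; $\Pi^a$ denotes the corresponding probability measure. $S_1^n:=X_1+\dots+X_n$. *)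

theory Defs
  imports "HOL-Probability.Probability"
begin

definition in_R :: "real \<Rightarrow> (real \<Rightarrow> real) \<Rightarrow> bool" where
  "in_R \<beta> h \<longleftrightarrow> (\<exists>l \<epsilon> :: real \<Rightarrow> real.
      (\<forall>x\<ge>1. \<epsilon> differentiable (at x) \<and> deriv \<epsilon> differentiable (at x)) \<and>
      (\<epsilon> \<longlongrightarrow> 0) at_top \<and>
      (\<forall>x\<ge>1. l x = exp (LBINT u=1..x. \<epsilon> u / u)) \<and>
      Limsup at_top (\<lambda>x. ereal (x * \<bar>deriv \<epsilon> x\<bar>)) < \<infinity> \<and>
      Limsup at_top (\<lambda>x. ereal (x\<^sup>2 * \<bar>deriv (deriv \<epsilon>) x\<bar>)) < \<infinity> \<and>
      (\<forall>\<^sub>F x in at_top. h x = x powr \<beta> * l x))"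

text \<open>psi(u) = inf { x : h(x) >= u }, x ranging over the domain [0,oo) of h.\<close>
definition psi :: "(real \<Rightarrow> real) \<Rightarrow> real \<Rightarrow> real" where
  "psi h u = Inf {x. 0 \<le> x \<and> u \<le> h x}"

definition mgf :: "(real \<Rightarrow> real) \<Rightarrow> real \<Rightarrow> real" where
  "mgf p t = (LINT x|lborel. exp (t * x) * p x)"

definition mfun :: "(real \<Rightarrow> real) \<Rightarrow> real \<Rightarrow> real" where
  "mfun p t = deriv (\<lambda>s. ln (mgf p s)) t"

definition tilted :: "(real \<Rightarrow> real) \<Rightarrow> real \<Rightarrow> real measure" where
  "tilted p t = density lborel (\<lambda>x. ennreal (exp (t * x) * p x / mgf p t))"

end

theory Submission
  imports Defs
begin

text \<open>
  Write $\Pi$ for the tilted law at $a_n$, $N = n - 1$, and $\sigma$ for the scale of $\Pi$. By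
  exchangeability, $P_{A_n}(X_1 \in B)$ is the conditional expectation of the frequency of $B$ among
  $X_1, \dots, X_N$. Under $\Pi^N$ this frequency deviates from $\Pi(B)$ by more than $\epsilon$ with
  probability at most $2 e^{-2 N \epsilon^2}$, uniformly in $B$, by Hoeffding's inequality. Because $\Pi$ has a density
  at most $C/\sigma$ everywhere and at least $c/\sigma$ within $2\sigma$ of its mean, conditioning
  on $A_n$ multiplies the probability of an event in $X_1, \dots, X_N$ by at most
  $(2C/c) / \Pi^N(|S_1^N - N a_n| \le \sigma)$ relative to $\Pi^N$, and the last probability is at least
  $e^{-o(N)}$. Hence $P_{A_n}(B) - \Pi(B) \to 0$. The constants $C, c$ come from Laplace's method at
  the saddle point $h(z) = t$.
\<close>

section \<open>Sums of independent variables near their mean\<close>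

text \<open>The tilted law moves with n, and Laplace's method controls its density only up to
  constant factors, so the argument is arranged to survive such losses. Summand n = N + 1 is held in
  reserve. Once the first N are fixed, with sum S, it only has to exceed s = n a_n - S. With phi the
  moment generating function at t, its tail at s is at most C phi / (t sigma) e^(-ts) for every s,
  and at least c phi / (2 t sigma) e^(-ts) when |s - a_n| <= sigma. The quotient of these constants
  is the 2C/c of the overview, and e^(-ts) carries the factor e^(tS) that turns the law of the first
  N summands into the tilted one. The lower tail bound integrates over [s, s + sigma], hence the
  radius 2 sigma for the density. Since Hoeffding's gain is exponential in N for fixed epsilon, a
  lower bound e^(-O(sqrt N)) for the central event is enough, and that needs only a variance bound
  and some mass on both sides of the mean. The absolute error becomes a relative one because the
  conditional probabilities stay away from zero.\<close>

lemma (in prob_space) indep_step_towards_zero: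
  fixes Y T :: "'a \<Rightarrow> real"
  assumes ind: "indep_var borel Y borel T"
    and neg: "prob {\<omega> \<in> space M. -\<sigma> \<le> Y \<omega> \<and> Y \<omega> \<le> -\<sigma>/2} \<ge> \<kappa>"
    and pos: "prob {\<omega> \<in> space M. \<sigma>/2 \<le> Y \<omega> \<and> Y \<omega> \<le> \<sigma>} \<ge> \<kappa>"
    and r: "r \<ge> 3/2" and \<sigma>: "\<sigma> > 0"
  shows "\<kappa> * prob {\<omega> \<in> space M. \<bar>T \<omega>\<bar> \<le> r * \<sigma>} \<le> prob {\<omega> \<in> space M. \<bar>Y \<omega> + T \<omega>\<bar> \<le> (r - 1/2) * \<sigma>}"
proof -
  have [measurable]: "Y \<in> borel_measurable M" "T \<in> borel_measurable M"
    using indep_var_rv1[OF ind] indep_var_rv2[OF ind] by auto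
  have split: "prob {\<omega> \<in> space M. Y \<omega> \<in> A \<and> T \<omega> \<in> B} =
      prob {\<omega> \<in> space M. Y \<omega> \<in> A} * prob {\<omega> \<in> space M. T \<omega> \<in> B}"
    if "A \<in> sets borel" "B \<in> sets borel" for A B
    using indep_varD[OF ind that] by (simp add: vimage_def Int_def conj_commute)
  \<comment> \<open>Y steps against the sign of T. A T far from zero moves inwards by at least
    \<sigma>/2; a T near zero overshoots at most to distance \<sigma>, which
    \<open>r \<ge> 3/2\<close> keeps inside the smaller window. Cutting T at zero half-openly makes
    the two cases disjoint.\<close>
  let ?P = "{\<omega> \<in> space M. T \<omega> \<in> {0..r*\<sigma>}}" and ?N = "{\<omega> \<in> space M. T \<omega> \<in> {-r*\<sigma>..<0}}"
  let ?P' = "{\<omega> \<in> space M. Y \<omega> \<in> {-\<sigma>..-\<sigma>/2} \<and> T \<omega> \<in> {0..r*\<sigma>}}"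
    and ?N' = "{\<omega> \<in> space M. Y \<omega> \<in> {\<sigma>/2..\<sigma>} \<and> T \<omega> \<in> {-r*\<sigma>..<0}}"
  have r\<sigma>: "r * \<sigma> \<ge> \<sigma> + \<sigma>/2" using mult_right_mono[OF r, of \<sigma>] \<sigma> by simp
  have "{\<omega> \<in> space M. \<bar>T \<omega>\<bar> \<le> r * \<sigma>} = ?P \<union> ?N" using r\<sigma> \<sigma> by auto
  then have "\<kappa> * prob {\<omega> \<in> space M. \<bar>T \<omega>\<bar> \<le> r * \<sigma>} = \<kappa> * prob ?P + \<kappa> * prob ?N"
    by (simp add: finite_measure_Union disjoint_iff distrib_left)
  also have "\<dots> \<le> prob {\<omega> \<in> space M. Y \<omega> \<in> {-\<sigma>..-\<sigma>/2}} * prob ?P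
                + prob {\<omega> \<in> space M. Y \<omega> \<in> {\<sigma>/2..\<sigma>}} * prob ?N"
    using neg pos by (intro add_mono mult_right_mono) auto
  also have "\<dots> = prob ?P' + prob ?N'"
    by (simp only: split atLeastLessThan_borel atLeastAtMost_borel)
  also have "\<dots> = prob (?P' \<union> ?N')"
    by (subst finite_measure_Union) auto
  also have "\<dots> \<le> prob {\<omega> \<in> space M. \<bar>Y \<omega> + T \<omega>\<bar> \<le> (r - 1/2) * \<sigma>}"
  proof -
    define R where "R = r * \<sigma>"
    have "R \<ge> \<sigma> + \<sigma>/2" "(r - 1/2) * \<sigma> = R - \<sigma>/2" "- r * \<sigma> = - R"
      using r\<sigma> by (simp_all add: R_def left_diff_distrib)
    moreover have "\<bar>y + u\<bar> \<le> R - \<sigma>/2"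
      if "-\<sigma> \<le> y \<and> y \<le> -\<sigma>/2 \<and> 0 \<le> u \<and> u \<le> R \<or> \<sigma>/2 \<le> y \<and> y \<le> \<sigma> \<and> - R \<le> u \<and> u < 0" for y u
      using that \<open>R \<ge> \<sigma> + \<sigma>/2\<close> by linarith
    ultimately show ?thesis
      unfolding R_def[symmetric] by (intro finite_measure_mono) auto
  qed
  finally show ?thesis .
qed

lemma (in prob_space) second_moment_sum:
  fixes Y :: "nat \<Rightarrow> 'a \<Rightarrow> real"
  assumes "indep_vars (\<lambda>_. borel) Y {1..N}"
    and "\<And>i. i \<in> {1..N} \<Longrightarrow> integrable M (Y i)"
    and "\<And>i. i \<in> {1..N} \<Longrightarrow> expectation (Y i) = 0"
    and "\<And>i. i \<in> {1..N} \<Longrightarrow> integrable M (\<lambda>\<omega>. (Y i \<omega>)\<^sup>2)"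
    and "\<And>i. i \<in> {1..N} \<Longrightarrow> expectation (\<lambda>\<omega>. (Y i \<omega>)\<^sup>2) \<le> V"
  shows "integrable M (\<lambda>\<omega>. (\<Sum>i=1..N. Y i \<omega>)\<^sup>2) \<and> expectation (\<lambda>\<omega>. (\<Sum>i=1..N. Y i \<omega>)\<^sup>2) \<le> N * V"
  using assms
proof (induction N)
  case 0
  then show ?case by simp
next
  case (Suc N)
  define T where "T = (\<lambda>\<omega>. \<Sum>i=1..N. Y i \<omega>)"
  have IH: "integrable M (\<lambda>\<omega>. (T \<omega>)\<^sup>2)" "expectation (\<lambda>\<omega>. (T \<omega>)\<^sup>2) \<le> N * V"
    using Suc.IH[OF indep_vars_subset[OF Suc.prems(1)]] Suc.prems unfolding T_def by auto
  have ins: "{1..Suc N} = insert (Suc N) {1..N}" by auto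
  have ind: "indep_var borel (Y (Suc N)) borel T"
    unfolding T_def by (rule indep_vars_sum) (use Suc.prems(1) ins in auto)
  have intT: "integrable M T" unfolding T_def using Suc.prems by auto
  have mT: "expectation T = 0" unfolding T_def using Suc.prems by (subst Bochner_Integration.integral_sum) auto
  have intY: "integrable M (Y (Suc N))" using Suc.prems by auto
  have prod: "integrable M (\<lambda>\<omega>. Y (Suc N) \<omega> * T \<omega>)" "expectation (\<lambda>\<omega>. Y (Suc N) \<omega> * T \<omega>) = 0"
    using indep_var_integrable[OF ind intY intT] indep_var_lebesgue_integral[OF ind intY intT] mT by auto
  have eq: "(\<Sum>i=1..Suc N. Y i \<omega>)\<^sup>2 = (Y (Suc N) \<omega>)\<^sup>2 + 2 * (Y (Suc N) \<omega> * T \<omega>) + (T \<omega>)\<^sup>2" for \<omega>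
    unfolding ins T_def by (simp add: power2_sum algebra_simps)
  have i1: "integrable M (\<lambda>\<omega>. (Y (Suc N) \<omega>)\<^sup>2)" and e1: "expectation (\<lambda>\<omega>. (Y (Suc N) \<omega>)\<^sup>2) \<le> V"
    using Suc.prems by auto
  show ?case
    unfolding eq using i1 e1 prod IH by (simp add: distrib_right)
qed

text \<open>Chebyshev keeps the sum of the first $N - m$ variables within $O(\sqrt N)\sigma$ of zero; each of the
  remaining $m \sim \sqrt N$ steps then narrows the window by $\sigma/2$ at the cost of a factor $\kappa$.
  The resulting bound is only $e^{-o(N)}$, but uniform over all laws sharing $\kappa$ and $V$.\<close>

lemma (in prob_space) prob_sum_near_zero_ge:
  fixes Y :: "nat \<Rightarrow> 'a \<Rightarrow> real"
  assumes ind: "indep_vars (\<lambda>_. borel) Y {1..N}"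
    and int: "\<And>i. i \<in> {1..N} \<Longrightarrow> integrable M (Y i)"
    and mean: "\<And>i. i \<in> {1..N} \<Longrightarrow> expectation (Y i) = 0"
    and int2: "\<And>i. i \<in> {1..N} \<Longrightarrow> integrable M (\<lambda>\<omega>. (Y i \<omega>)\<^sup>2)"
    and var: "\<And>i. i \<in> {1..N} \<Longrightarrow> expectation (\<lambda>\<omega>. (Y i \<omega>)\<^sup>2) \<le> V * \<sigma>\<^sup>2"
    and neg: "\<And>i. i \<in> {1..N} \<Longrightarrow> prob {\<omega> \<in> space M. -\<sigma> \<le> Y i \<omega> \<and> Y i \<omega> \<le> -\<sigma>/2} \<ge> \<kappa>"
    and pos: "\<And>i. i \<in> {1..N} \<Longrightarrow> prob {\<omega> \<in> space M. \<sigma>/2 \<le> Y i \<omega> \<and> Y i \<omega> \<le> \<sigma>} \<ge> \<kappa>"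
    and \<sigma>: "\<sigma> > 0" and \<kappa>: "\<kappa> \<ge> 0" and V: "V \<ge> 0" and m: "m \<le> N" "8 * V * real N \<le> (real m)\<^sup>2"
  shows "\<kappa> ^ m / 2 \<le> prob {\<omega> \<in> space M. \<bar>\<Sum>i=1..N. Y i \<omega>\<bar> \<le> \<sigma>}"
proof -
  define T where "T = (\<lambda>j \<omega>. \<Sum>i=1..j. Y i \<omega>)"
  have Ym[measurable]: "i \<in> {1..N} \<Longrightarrow> Y i \<in> borel_measurable M" for i
    using int by auto
  have step: "\<kappa> * prob {\<omega> \<in> space M. \<bar>T j \<omega>\<bar> \<le> r * \<sigma>} \<le> prob {\<omega> \<in> space M. \<bar>T (Suc j) \<omega>\<bar> \<le> (r - 1/2) * \<sigma>}"
    if "j < N" "r \<ge> 3/2" for j r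
  proof -
    have "indep_vars (\<lambda>_. borel) Y (insert (Suc j) {1..j})"
      using that by (intro indep_vars_subset[OF ind]) auto
    then have "indep_var borel (Y (Suc j)) borel (T j)"
      unfolding T_def by (intro indep_vars_sum) auto
    from indep_step_towards_zero[OF this neg pos that(2) \<sigma>]
    show ?thesis using that(1) by (simp add: T_def add.commute)
  qed
  define j where "j = N - m"
  \<comment> \<open>The width 1 + m/2 is what m reductions by 1/2 bring down to 1. Its square is at
    least m^2/4, hence at least 2VN, so Chebyshev leaves probability at least 1/2.\<close>
  have base: "1/2 \<le> prob {\<omega> \<in> space M. \<bar>T j \<omega>\<bar> \<le> (1 + real m/2) * \<sigma>}"
  proof -
    have sub: "{1..j} \<subseteq> {1..N}" by (auto simp: j_def)
    have sm: "integrable M (\<lambda>\<omega>. (T j \<omega>)\<^sup>2) \<and> expectation (\<lambda>\<omega>. (T j \<omega>)\<^sup>2) \<le> j * (V * \<sigma>\<^sup>2)"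
      unfolding T_def
      by (rule second_moment_sum) (use sub int mean int2 var indep_vars_subset[OF ind sub] in auto)
    have [measurable]: "T j \<in> borel_measurable M"
      unfolding T_def using sub Ym by (intro borel_measurable_sum) auto
    have "expectation (T j) = 0"
      unfolding T_def using sub int mean by (subst Bochner_Integration.integral_sum) auto
    define R where "R = (1 + real m/2) * \<sigma>"
    have R: "R > 0" using \<sigma> by (simp add: R_def)
    have "prob {\<omega> \<in> space M. \<bar>T j \<omega>\<bar> \<ge> R} \<le> expectation (\<lambda>\<omega>. (T j \<omega>)\<^sup>2) / R\<^sup>2"
      using Chebyshev_inequality[of "T j" R] sm R \<open>expectation (T j) = 0\<close> by simp
    also have "\<dots> \<le> (real N * V * \<sigma>\<^sup>2) / R\<^sup>2"
    proof (rule divide_right_mono)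
      have "real j * (V * \<sigma>\<^sup>2) \<le> real N * (V * \<sigma>\<^sup>2)" using V by (intro mult_right_mono) (auto simp: j_def)
      then show "expectation (\<lambda>\<omega>. (T j \<omega>)\<^sup>2) \<le> real N * V * \<sigma>\<^sup>2" using sm by simp
    qed simp
    also have "\<dots> \<le> 1/2"
    proof -
      have "8 * V * real N \<le> 4 * (1 + real m/2)\<^sup>2"
        using m(2) by (simp add: power2_eq_square algebra_simps)
      then have "2 * (real N * V) \<le> (1 + real m/2)\<^sup>2" by (simp add: algebra_simps)
      then have "2 * (real N * V) * \<sigma>\<^sup>2 \<le> (1 + real m/2)\<^sup>2 * \<sigma>\<^sup>2"
        by (intro mult_right_mono) auto
      then have "2 * (real N * V * \<sigma>\<^sup>2) \<le> R\<^sup>2" by (simp add: R_def power_mult_distrib)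
      then show ?thesis using R by (simp add: divide_le_eq)
    qed
    finally have le: "prob {\<omega> \<in> space M. \<bar>T j \<omega>\<bar> \<ge> R} \<le> 1/2" .
    have "1 = prob ({\<omega> \<in> space M. \<bar>T j \<omega>\<bar> \<le> R} \<union> {\<omega> \<in> space M. \<bar>T j \<omega>\<bar> \<ge> R})"
      by (subst prob_space[symmetric], rule arg_cong[where f=prob]) auto
    also have "\<dots> \<le> prob {\<omega> \<in> space M. \<bar>T j \<omega>\<bar> \<le> R} + prob {\<omega> \<in> space M. \<bar>T j \<omega>\<bar> \<ge> R}"
      by (rule measure_Un_le) measurable
    finally show ?thesis using le unfolding R_def by simp
  qed
  have "\<kappa> ^ l / 2 \<le> prob {\<omega> \<in> space M. \<bar>T (j + l) \<omega>\<bar> \<le> (1 + (real m - l)/2) * \<sigma>}" if "l \<le> m" for l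
    using that
  proof (induction l)
    case 0
    then show ?case using base by simp
  next
    case (Suc l)
    have "\<kappa> ^ Suc l / 2 = \<kappa> * (\<kappa> ^ l / 2)" by simp
    also have "\<dots> \<le> \<kappa> * prob {\<omega> \<in> space M. \<bar>T (j + l) \<omega>\<bar> \<le> (1 + (real m - l)/2) * \<sigma>}"
      using Suc \<kappa> by (intro mult_left_mono) auto
    \<comment> \<open>Since l < m, the current width is at least 3/2, as a further step
      requires.\<close>
    also have "\<dots> \<le> prob {\<omega> \<in> space M. \<bar>T (Suc (j + l)) \<omega>\<bar> \<le> ((1 + (real m - l)/2) - 1/2) * \<sigma>}"
      using Suc.prems m by (intro step) (auto simp: j_def)
    also have "(1 + (real m - l)/2) - 1/2 = 1 + (real m - Suc l)/2" by (simp add: field_simps)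
    finally show ?case by simp
  qed
  from this[of m] show ?thesis using m(1) by (simp add: j_def T_def)
qed

section \<open>Exponential tilting of product measures\<close>

lemma PiM_density:
  fixes M :: "'a measure" and f :: "'a \<Rightarrow> ennreal"
  assumes "prob_space M" "prob_space (density M f)" and f[measurable]: "f \<in> borel_measurable M" and I: "finite I"
  shows "PiM I (\<lambda>_. density M f) = density (PiM I (\<lambda>_. M)) (\<lambda>\<omega>. \<Prod>i\<in>I. f (\<omega> i))"
proof -
  interpret M: product_prob_space "\<lambda>_. M" I
    by (intro product_prob_spaceI assms)
  interpret D: product_prob_space "\<lambda>_. density M f" I
    by (intro product_prob_spaceI assms)
  show ?thesis
  proof (rule D.PiM_eqI[symmetric, OF I])
    show "sets (density (PiM I (\<lambda>_. M)) (\<lambda>\<omega>. \<Prod>i\<in>I. f (\<omega> i))) = sets (PiM I (\<lambda>_. density M f))"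
      by (auto intro!: sets_PiM_cong)
    fix A assume "\<And>i. i \<in> I \<Longrightarrow> A i \<in> sets (density M f)"
    then have A[measurable]: "\<And>i. i \<in> I \<Longrightarrow> A i \<in> sets M" by simp
    have "emeasure (density (PiM I (\<lambda>_. M)) (\<lambda>\<omega>. \<Prod>i\<in>I. f (\<omega> i))) (Pi\<^sub>E I A)
        = (\<integral>\<^sup>+\<omega>. (\<Prod>i\<in>I. f (\<omega> i)) * indicator (Pi\<^sub>E I A) \<omega> \<partial>PiM I (\<lambda>_. M))"
      using I by (intro emeasure_density) auto
    also have "\<dots> = (\<integral>\<^sup>+\<omega>. (\<Prod>i\<in>I. f (\<omega> i) * indicator (A i) (\<omega> i)) \<partial>PiM I (\<lambda>_. M))"
    proof (intro nn_integral_cong)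
      fix \<omega> assume "\<omega> \<in> space (PiM I (\<lambda>_. M))"
      \<comment> \<open>Membership in \<open>Pi\<^sub>E I A\<close> includes extensionality. Points
        of the product space have it already, so there the indicator of the box factors over the
        coordinates.\<close>
      then have "\<omega> \<in> extensional I" by (auto simp: space_PiM PiE_def)
      then have "indicator (Pi\<^sub>E I A) \<omega> = (\<Prod>i\<in>I. indicator (A i) (\<omega> i) :: ennreal)"
        using I by (auto simp: indicator_def PiE_def Pi_def prod_zero_iff split: if_splits)
      then show "(\<Prod>i\<in>I. f (\<omega> i)) * indicator (Pi\<^sub>E I A) \<omega> = (\<Prod>i\<in>I. f (\<omega> i) * indicator (A i) (\<omega> i))"
        by (simp add: prod.distrib)
    qed
    also have "\<dots> = (\<Prod>i\<in>I. \<integral>\<^sup>+x. f x * indicator (A i) x \<partial>M)"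
      using I by (intro M.product_nn_integral_prod) auto
    also have "\<dots> = (\<Prod>i\<in>I. emeasure (density M f) (A i))"
      by (intro prod.cong refl emeasure_density[symmetric]) auto
    finally show "emeasure (density (PiM I (\<lambda>_. M)) (\<lambda>\<omega>. \<Prod>i\<in>I. f (\<omega> i))) (Pi\<^sub>E I A) = \<dots>" .
  qed
qed

text \<open>This is the exponential change of measure for N independent summands: the densities of
  the factors multiply to e^(tS) / \<phi>^N, with S the sum. That the tilted density is a
  probability measure identifies \<phi> with the moment generating function of P at t.\<close>

lemma nn_integral_PiM_exp_tilt:
  fixes P :: "real measure"
  assumes P: "prob_space P" "prob_space (density P (\<lambda>x. ennreal (exp (t * x) / \<phi>)))"
    and sP[measurable_cong]: "sets P = sets borel" and \<phi>: "\<phi> > 0" and D: "D \<in> sets (PiM {1..N::nat} (\<lambda>_. P))"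
  shows "(\<integral>\<^sup>+\<omega>. ennreal (exp (t * (\<Sum>i=1..N. \<omega> i))) * indicator D \<omega> \<partial>PiM {1..N} (\<lambda>_. P))
       = ennreal (\<phi> ^ N) * emeasure (PiM {1..N} (\<lambda>_. density P (\<lambda>x. ennreal (exp (t * x) / \<phi>)))) D"
proof -
  have D'[measurable]: "D \<in> sets (PiM {1..N} (\<lambda>_. borel))"
    using D by (subst sets_PiM_cong[OF refl, of _ _ "\<lambda>_. P"]) (auto simp: sP)
  have "emeasure (PiM {1..N} (\<lambda>_. density P (\<lambda>x. ennreal (exp (t * x) / \<phi>)))) D
      = (\<integral>\<^sup>+\<omega>. (\<Prod>i\<in>{1..N}. ennreal (exp (t * \<omega> i) / \<phi>)) * indicator D \<omega> \<partial>PiM {1..N} (\<lambda>_. P))"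
    by (subst PiM_density) (use P D in \<open>auto intro!: emeasure_density\<close>)
  also have "\<dots> = (\<integral>\<^sup>+\<omega>. ennreal (1 / \<phi> ^ N) * (ennreal (exp (t * (\<Sum>i=1..N. \<omega> i))) * indicator D \<omega>) \<partial>PiM {1..N} (\<lambda>_. P))"
    using \<phi> by (intro nn_integral_cong)
      (simp add: prod_ennreal prod_dividef exp_sum[symmetric] sum_distrib_left ennreal_mult'[symmetric] divide_ennreal mult.assoc[symmetric])
  also have "\<dots> = ennreal (1 / \<phi> ^ N) * (\<integral>\<^sup>+\<omega>. ennreal (exp (t * (\<Sum>i=1..N. \<omega> i))) * indicator D \<omega> \<partial>PiM {1..N} (\<lambda>_. P))"
    by (intro nn_integral_cmult) measurable
  finally show ?thesis
    using \<phi> by (simp add: mult.assoc[symmetric] ennreal_mult'[symmetric])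
qed

text \<open>Fubini in the last coordinate: once the others are fixed, the constraint on the sum
  leaves a half-line for it. All that the conditioning retains of the last summand is therefore a
  tail of P at a random point.\<close>

lemma emeasure_PiM_Suc_tail:
  fixes P :: "real measure"
  assumes P: "prob_space P" and sP[measurable_cong]: "sets P = sets borel"
    and D: "D \<in> sets (PiM {1..N::nat} (\<lambda>_. P))"
  shows "emeasure (PiM {1..Suc N} (\<lambda>_. P)) {\<omega> \<in> space (PiM {1..Suc N} (\<lambda>_. P)).
            restrict \<omega> {1..N} \<in> D \<and> b \<le> (\<Sum>i=1..Suc N. \<omega> i)}
       = (\<integral>\<^sup>+\<omega>. emeasure P {b - (\<Sum>i=1..N. \<omega> i)..} * indicator D \<omega> \<partial>PiM {1..N} (\<lambda>_. P))"
proof -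
  interpret product_prob_space "\<lambda>_::nat. P" UNIV
    by (intro product_prob_spaceI P)
  have ins: "{1..Suc N} = insert (Suc N) {1..N}" by auto
  let ?E = "{\<omega> \<in> space (PiM {1..Suc N} (\<lambda>_. P)). restrict \<omega> {1..N} \<in> D \<and> b \<le> (\<Sum>i=1..Suc N. \<omega> i)}"
  have r: "(\<lambda>\<omega>. restrict \<omega> {1..N}) \<in> measurable (PiM {1..Suc N} (\<lambda>_. P)) (PiM {1..N} (\<lambda>_. P))"
    by (intro measurable_restrict_subset) auto
  have "(\<lambda>\<omega>. restrict \<omega> {1..N}) -` D \<inter> space (PiM {1..Suc N} (\<lambda>_. P)) \<in> sets (PiM {1..Suc N} (\<lambda>_. P))"
    using measurable_sets[OF r D] .
  moreover have "{\<omega> \<in> space (PiM {1..Suc N} (\<lambda>_. P)). b \<le> (\<Sum>i=1..Suc N. \<omega> i)} \<in> sets (PiM {1..Suc N} (\<lambda>_. P))"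
    by measurable
  ultimately have "((\<lambda>\<omega>. restrict \<omega> {1..N}) -` D \<inter> space (PiM {1..Suc N} (\<lambda>_. P))) \<inter>
      {\<omega> \<in> space (PiM {1..Suc N} (\<lambda>_. P)). b \<le> (\<Sum>i=1..Suc N. \<omega> i)} \<in> sets (PiM {1..Suc N} (\<lambda>_. P))"
    by (rule sets.Int)
  also have "((\<lambda>\<omega>. restrict \<omega> {1..N}) -` D \<inter> space (PiM {1..Suc N} (\<lambda>_. P))) \<inter>
      {\<omega> \<in> space (PiM {1..Suc N} (\<lambda>_. P)). b \<le> (\<Sum>i=1..Suc N. \<omega> i)} = ?E" by auto
  finally have E: "?E \<in> sets (PiM {1..Suc N} (\<lambda>_. P))" .
  have "emeasure (PiM {1..Suc N} (\<lambda>_. P)) ?E = (\<integral>\<^sup>+\<omega>. indicator ?E \<omega> \<partial>PiM (insert (Suc N) {1..N}) (\<lambda>_. P))"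
    using E unfolding ins[symmetric] by simp
  also have "\<dots> = (\<integral>\<^sup>+\<omega>. (\<integral>\<^sup>+y. indicator ?E (fun_upd \<omega> (Suc N) y) \<partial>P) \<partial>PiM {1..N} (\<lambda>_. P))"
    using E unfolding ins by (intro product_nn_integral_insert) auto
  also have "\<dots> = (\<integral>\<^sup>+\<omega>. \<integral>\<^sup>+y. indicator {b - (\<Sum>i=1..N. \<omega> i)..} y * indicator D \<omega> \<partial>P \<partial>PiM {1..N} (\<lambda>_. P))"
  proof (intro nn_integral_cong)
    fix \<omega> y assume \<omega>: "\<omega> \<in> space (PiM {1..N} (\<lambda>_. P))" "y \<in> space P"
    then have "fun_upd \<omega> (Suc N) y \<in> space (PiM {1..Suc N} (\<lambda>_. P))"
      by (auto simp: space_PiM PiE_def extensional_def)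
    moreover have "restrict (fun_upd \<omega> (Suc N) y) {1..N} = \<omega>"
      using \<omega> by (auto simp: space_PiM PiE_def extensional_def fun_eq_iff)
    moreover have "(\<Sum>i=1..Suc N. (fun_upd \<omega> (Suc N) y) i) = y + (\<Sum>i=1..N. \<omega> i)"
      unfolding ins by simp
    ultimately show "indicator ?E (fun_upd \<omega> (Suc N) y) = (indicator {b - (\<Sum>i=1..N. \<omega> i)..} y * indicator D \<omega> :: ennreal)"
      by (auto simp: indicator_def)
  qed
  also have "\<dots> = (\<integral>\<^sup>+\<omega>. emeasure P {b - (\<Sum>i=1..N. \<omega> i)..} * indicator D \<omega> \<partial>PiM {1..N} (\<lambda>_. P))"
    by (intro nn_integral_cong) (simp add: nn_integral_multc sP)
  finally show ?thesis .
qed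

text \<open>At s = b - S the tail bound reads U e^(-tb) e^(tS), and e^(tS) is exactly the factor
  that turns the law of the first N coordinates into the tilted product.\<close>

lemma emeasure_tail_event_le:
  fixes P :: "real measure"
  assumes P: "prob_space P" "prob_space (density P (\<lambda>x. ennreal (exp (t * x) / \<phi>)))"
    and sP[measurable_cong]: "sets P = sets borel" and \<phi>: "\<phi> > 0" and D: "D \<in> sets (PiM {1..N::nat} (\<lambda>_. P))"
    and U: "\<And>s. emeasure P {s..} \<le> ennreal (U * exp (- t * s))" "U \<ge> 0"
  shows "emeasure (PiM {1..Suc N} (\<lambda>_. P)) {\<omega> \<in> space (PiM {1..Suc N} (\<lambda>_. P)).
            restrict \<omega> {1..N} \<in> D \<and> b \<le> (\<Sum>i=1..Suc N. \<omega> i)}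
       \<le> ennreal (U * exp (- t * b) * \<phi> ^ N) * emeasure (PiM {1..N} (\<lambda>_. density P (\<lambda>x. ennreal (exp (t * x) / \<phi>)))) D"
proof -
  have D'[measurable]: "D \<in> sets (PiM {1..N} (\<lambda>_. borel))"
    using D by (subst sets_PiM_cong[OF refl, of _ _ "\<lambda>_. P"]) (auto simp: sP)
  have "(\<integral>\<^sup>+\<omega>. emeasure P {b - (\<Sum>i=1..N. \<omega> i)..} * indicator D \<omega> \<partial>PiM {1..N} (\<lambda>_. P))
      \<le> (\<integral>\<^sup>+\<omega>. ennreal (U * exp (- t * b)) * (ennreal (exp (t * (\<Sum>i=1..N. \<omega> i))) * indicator D \<omega>) \<partial>PiM {1..N} (\<lambda>_. P))"
  proof (intro nn_integral_mono)
    fix \<omega> :: "nat \<Rightarrow> real"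
    have "U * exp (- t * (b - (\<Sum>i=1..N. \<omega> i))) = U * exp (- t * b) * exp (t * (\<Sum>i=1..N. \<omega> i))"
      by (simp add: mult_exp_exp algebra_simps)
    then show "emeasure P {b - (\<Sum>i=1..N. \<omega> i)..} * indicator D \<omega>
        \<le> ennreal (U * exp (- t * b)) * (ennreal (exp (t * (\<Sum>i=1..N. \<omega> i))) * indicator D \<omega>)"
      using U(1)[of "b - (\<Sum>i=1..N. \<omega> i)"] U(2)
      by (auto simp: indicator_def ennreal_mult'[symmetric] mult.assoc simp del: minus_mult_left)
  qed
  also have "\<dots> = ennreal (U * exp (- t * b)) * (\<integral>\<^sup>+\<omega>. (ennreal (exp (t * (\<Sum>i=1..N. \<omega> i))) * indicator D \<omega>) \<partial>PiM {1..N} (\<lambda>_. P))"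
    by (intro nn_integral_cmult) measurable
  finally show ?thesis
    using \<phi> U(2) unfolding emeasure_PiM_Suc_tail[OF P(1) sP D] nn_integral_PiM_exp_tilt[OF P sP \<phi> D]
    by (simp add: ennreal_mult'' mult.assoc)
qed

text \<open>The counterpart from below has tail bounds only for s within \<sigma> of a. With the
  threshold (N + 1) a, s - a is minus the centred sum of the first N coordinates, so only
  configurations with centred sum of modulus at most \<sigma> are counted.\<close>

lemma emeasure_tail_event_ge:
  fixes P :: "real measure"
  assumes P: "prob_space P" "prob_space (density P (\<lambda>x. ennreal (exp (t * x) / \<phi>)))"
    and sP[measurable_cong]: "sets P = sets borel" and \<phi>: "\<phi> > 0"
    and L: "\<And>s. \<bar>s - a\<bar> \<le> \<sigma> \<Longrightarrow> ennreal (L * exp (- t * s)) \<le> emeasure P {s..}" "L \<ge> 0"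
  shows "ennreal (L * exp (- t * (real (Suc N) * a)) * \<phi> ^ N) * emeasure (PiM {1..N} (\<lambda>_. density P (\<lambda>x. ennreal (exp (t * x) / \<phi>))))
            {\<omega> \<in> space (PiM {1..N} (\<lambda>_. P)). \<bar>\<Sum>i=1..N. \<omega> i - a\<bar> \<le> \<sigma>}
      \<le> emeasure (PiM {1..Suc N} (\<lambda>_. P)) {\<omega> \<in> space (PiM {1..Suc N} (\<lambda>_. P)). real (Suc N) * a \<le> (\<Sum>i=1..Suc N. \<omega> i)}"
proof -
  let ?D = "{\<omega> \<in> space (PiM {1..N} (\<lambda>_. P)). \<bar>\<Sum>i=1..N. \<omega> i - a\<bar> \<le> \<sigma>}" and ?b = "real (Suc N) * a"
  have D: "?D \<in> sets (PiM {1..N} (\<lambda>_. P))" by measurable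
  have D'[measurable]: "?D \<in> sets (PiM {1..N} (\<lambda>_. borel))"
    using D by (subst sets_PiM_cong[OF refl, of _ _ "\<lambda>_. P"]) (auto simp: sP)
  have "ennreal (L * exp (- t * ?b) * \<phi> ^ N) * emeasure (PiM {1..N} (\<lambda>_. density P (\<lambda>x. ennreal (exp (t * x) / \<phi>)))) ?D
    = ennreal (L * exp (- t * ?b)) * (\<integral>\<^sup>+\<omega>. (ennreal (exp (t * (\<Sum>i=1..N. \<omega> i))) * indicator ?D \<omega>) \<partial>PiM {1..N} (\<lambda>_. P))"
    using \<phi> L(2) unfolding nn_integral_PiM_exp_tilt[OF P sP \<phi> D]
    by (simp add: ennreal_mult'' mult.assoc)
  also have "\<dots> = (\<integral>\<^sup>+\<omega>. ennreal (L * exp (- t * ?b)) * (ennreal (exp (t * (\<Sum>i=1..N. \<omega> i))) * indicator ?D \<omega>) \<partial>PiM {1..N} (\<lambda>_. P))"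
    by (intro nn_integral_cmult[symmetric]) measurable
  also have "\<dots> \<le> (\<integral>\<^sup>+\<omega>. emeasure P {?b - (\<Sum>i=1..N. \<omega> i)..} * indicator ?D \<omega> \<partial>PiM {1..N} (\<lambda>_. P))"
  proof (intro nn_integral_mono)
    fix \<omega> :: "nat \<Rightarrow> real"
    let ?s = "?b - (\<Sum>i=1..N. \<omega> i)"
    have *: "L * exp (- t * ?s) = L * exp (- t * ?b) * exp (t * (\<Sum>i=1..N. \<omega> i))"
      by (simp add: mult_exp_exp algebra_simps)
    show "ennreal (L * exp (- t * ?b)) * (ennreal (exp (t * (\<Sum>i=1..N. \<omega> i))) * indicator ?D \<omega>)
        \<le> emeasure P {?s..} * indicator ?D \<omega>"
    proof (cases "\<omega> \<in> ?D")
      case True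
      then have "\<bar>?s - a\<bar> \<le> \<sigma>" by (simp add: sum_subtractf algebra_simps abs_le_iff)
      from L(1)[OF this] True L(2) show ?thesis
        unfolding * by (simp add: ennreal_mult'[symmetric] mult.assoc del: minus_mult_left)
    qed simp
  qed
  also have "\<dots> = emeasure (PiM {1..Suc N} (\<lambda>_. P)) {\<omega> \<in> space (PiM {1..Suc N} (\<lambda>_. P)).
            restrict \<omega> {1..N} \<in> ?D \<and> ?b \<le> (\<Sum>i=1..Suc N. \<omega> i)}"
    by (rule emeasure_PiM_Suc_tail[OF P(1) sP D, symmetric])
  also have "\<dots> \<le> emeasure (PiM {1..Suc N} (\<lambda>_. P)) {\<omega> \<in> space (PiM {1..Suc N} (\<lambda>_. P)). ?b \<le> (\<Sum>i=1..Suc N. \<omega> i)}"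
    by (intro emeasure_mono) (auto, measurable)
  finally show ?thesis .
qed

section \<open>Exchangeability and concentration of coordinate frequencies\<close>

lemma indep_vars_PiM_coordinates:
  assumes P: "prob_space P" and sP: "sets P = sets S" and I: "I \<noteq> {}"
  shows "prob_space.indep_vars (PiM I (\<lambda>_. P)) (\<lambda>_. S) (\<lambda>i \<omega>. \<omega> i) I"
proof -
  interpret Q: prob_space "PiM I (\<lambda>_. P)" by (intro prob_space_PiM P)
  have meas: "(\<lambda>\<omega>. \<omega> i) \<in> measurable (PiM I (\<lambda>_. P)) S" if "i \<in> I" for i
    using that by (simp add: measurable_cong_sets[OF refl sP[symmetric]])
  have "distr (PiM I (\<lambda>_. P)) (PiM I (\<lambda>_. S)) (\<lambda>\<omega>. \<lambda>i\<in>I. \<omega> i) = distr (PiM I (\<lambda>_. P)) (PiM I (\<lambda>_. P)) (\<lambda>\<omega>. \<omega>)"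
    by (intro distr_cong sets_PiM_cong) (auto simp: sP space_PiM PiE_def extensional_def)
  also have "\<dots> = PiM I (\<lambda>i. distr (PiM I (\<lambda>_. P)) S (\<lambda>\<omega>. \<omega> i))"
  proof -
    have "distr (PiM I (\<lambda>_. P)) S (\<lambda>\<omega>. \<omega> i) = P" if "i \<in> I" for i
      using distr_PiM_component[of I "\<lambda>_. P" i] P that
      by (metis distr_cong sP)
    then show ?thesis by (subst distr_id) (auto intro!: PiM_cong)
  qed
  finally show ?thesis
    by (subst Q.indep_vars_iff_distr_eq_PiM'[OF I meas]) auto
qed

text \<open>Transposing two coordinates preserves the product measure and the sum. Hence, under the
  constraint on the sum, every coordinate is equally likely to lie in B.\<close>

lemma measure_PiM_swap:
  fixes P :: "real measure"
  assumes P: "prob_space P" and sP[measurable_cong]: "sets P = sets borel" and B[measurable]: "B \<in> sets borel"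
    and ij: "i \<in> {1..n::nat}" "j \<in> {1..n}"
  shows "measure (PiM {1..n} (\<lambda>_. P)) {\<omega> \<in> space (PiM {1..n} (\<lambda>_. P)). \<omega> i \<in> B \<and> b \<le> (\<Sum>l=1..n. \<omega> l)}
       = measure (PiM {1..n} (\<lambda>_. P)) {\<omega> \<in> space (PiM {1..n} (\<lambda>_. P)). \<omega> j \<in> B \<and> b \<le> (\<Sum>l=1..n. \<omega> l)}"
proof -
  let ?Q = "PiM {1..n} (\<lambda>_. P)" and ?f = "Transposition.transpose i j"
  let ?E = "\<lambda>i. {\<omega> \<in> space ?Q. \<omega> i \<in> B \<and> b \<le> (\<Sum>l=1..n. \<omega> l)}"
  have f: "?f permutes {1..n}" using ij by (rule permutes_swap_id)
  have fi: "?f l \<in> {1..n} \<longleftrightarrow> l \<in> {1..n}" for l using permutes_in_image[OF f] .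
  have g: "(\<lambda>\<omega>. \<lambda>l\<in>{1..n}. \<omega> (?f l)) \<in> measurable ?Q ?Q"
    by (rule measurable_restrict) (use fi measurable_component_singleton[of "?f _" "{1..n}" "\<lambda>_. P"] in blast)
  have "{\<omega> \<in> space ?Q. b \<le> (\<Sum>l=1..n. \<omega> l)} \<in> sets ?Q" by measurable
  moreover have "(\<lambda>\<omega>. \<omega> i) -` B \<inter> space ?Q \<in> sets ?Q"
    using ij B sP by (intro measurable_sets[OF measurable_component_singleton]) auto
  ultimately have "((\<lambda>\<omega>. \<omega> i) -` B \<inter> space ?Q) \<inter> {\<omega> \<in> space ?Q. b \<le> (\<Sum>l=1..n. \<omega> l)} \<in> sets ?Q"
    by (rule sets.Int[rotated])
  also have "((\<lambda>\<omega>. \<omega> i) -` B \<inter> space ?Q) \<inter> {\<omega> \<in> space ?Q. b \<le> (\<Sum>l=1..n. \<omega> l)} = ?E i" by auto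
  finally have E: "?E i \<in> sets ?Q" .
  have "measure ?Q (?E i) = measure (distr ?Q ?Q (\<lambda>\<omega>. \<lambda>l\<in>{1..n}. \<omega> (?f l))) (?E i)"
    using distr_PiM_reindex[of "{1..n}" "\<lambda>_. P" ?f "{1..n}"] P permutes_inj_on[OF f] fi by auto
  also have "\<dots> = measure ?Q ((\<lambda>\<omega>. \<lambda>l\<in>{1..n}. \<omega> (?f l)) -` ?E i \<inter> space ?Q)"
    by (rule measure_distr[OF g E])
  also have "(\<lambda>\<omega>. \<lambda>l\<in>{1..n}. \<omega> (?f l)) -` ?E i \<inter> space ?Q = ?E j"
  proof -
    have "(\<Sum>l=1..n. \<omega> (?f l)) = (\<Sum>l=1..n. \<omega> l)" for \<omega> :: "nat \<Rightarrow> real"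
      using sum.permute[OF f, of \<omega>] by (simp add: comp_def)
    moreover have "(\<lambda>l\<in>{1..n}. \<omega> (?f l)) \<in> space ?Q" if "\<omega> \<in> space ?Q" for \<omega>
      using measurable_space[OF g that] .
    ultimately show ?thesis using ij by auto
  qed
  finally show ?thesis .
qed

text \<open>Adding the N equal probabilities turns \<beta> into the mean of a count restricted to A.
  Off D the count differs from N \<pi> by at most N \<epsilon>; on D it differs by at most N,
  because both numbers lie between 0 and N. The bound is kept free of division, so
  \<open>prob A\<close> may be estimated separately.\<close>

lemma (in prob_space) exchangeable_frequency_bound:
  fixes B :: "nat \<Rightarrow> 'a set" and A D :: "'a set"
  assumes A: "A \<in> events" and D: "D \<in> events" and B: "\<And>i. i \<in> {1..N} \<Longrightarrow> B i \<in> events"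
    and \<beta>: "\<And>i. i \<in> {1..N} \<Longrightarrow> prob (B i \<inter> A) = \<beta>" and \<pi>: "0 \<le> \<pi>" "\<pi> \<le> 1" and N: "N > 0" and \<epsilon>: "\<epsilon> \<ge> 0"
    and freq: "\<And>\<omega>. \<omega> \<in> A - D \<Longrightarrow> \<bar>(\<Sum>i=1..N. indicator (B i) \<omega>) - N * \<pi>\<bar> \<le> N * \<epsilon>"
  shows "\<bar>\<beta> - \<pi> * prob A\<bar> \<le> \<epsilon> * prob A + prob (A \<inter> D)"
proof -
  have int: "integrable M (indicator E :: 'a \<Rightarrow> real)" if "E \<in> events" for E
    using that by (simp add: integrable_indicator_iff emeasure_eq_measure)
  let ?F = "\<lambda>\<omega>. (\<Sum>i=1..N. indicator (B i \<inter> A) \<omega>) - N * \<pi> * indicator A \<omega> :: real"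
  have iF: "integrable M ?F"
    using A B by (auto intro!: Bochner_Integration.integrable_diff Bochner_Integration.integrable_sum int)
  have iS: "integrable M (\<lambda>\<omega>. \<Sum>i=1..N. indicator (B i \<inter> A) \<omega> :: real)"
    using A B by (auto intro!: Bochner_Integration.integrable_sum int)
  have "expectation (\<lambda>\<omega>. \<Sum>i=1..N. indicator (B i \<inter> A) \<omega> :: real) = (\<Sum>i=1..N. prob (B i \<inter> A))"
    using A B by (subst Bochner_Integration.integral_sum) (auto intro!: int sum.cong)
  then have "expectation ?F = N * \<beta> - N * \<pi> * prob A"
    using A B \<beta> by (subst Bochner_Integration.integral_diff[OF iS]) (auto intro!: int)
  then have "N * \<bar>\<beta> - \<pi> * prob A\<bar> = \<bar>expectation ?F\<bar>"
    by (simp add: right_diff_distrib[symmetric] abs_mult mult.assoc)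
  also have "\<dots> \<le> expectation (\<lambda>\<omega>. \<bar>?F \<omega>\<bar>)" by (rule integral_abs_bound)
  also have "\<dots> \<le> expectation (\<lambda>\<omega>. real N * \<epsilon> * indicator A \<omega> + real N * indicator (A \<inter> D) \<omega>)"
  proof (rule integral_mono)
    show "integrable M (\<lambda>\<omega>. real N * \<epsilon> * indicator A \<omega> + real N * indicator (A \<inter> D) \<omega>)"
      using A D by (intro Bochner_Integration.integrable_add Bochner_Integration.integrable_mult_right int) auto
    fix \<omega> assume "\<omega> \<in> space M"
    let ?S = "\<Sum>i=1..N. indicator (B i) \<omega> :: real"
    show "\<bar>?F \<omega>\<bar> \<le> real N * \<epsilon> * indicator A \<omega> + real N * indicator (A \<inter> D) \<omega>"
    proof (cases "\<omega> \<in> A")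
      case True
      have "?S \<le> (\<Sum>i=1..N. 1)" by (rule sum_mono) (simp add: indicator_def)
      moreover have "?S \<ge> 0" by (rule sum_nonneg) simp
      moreover have "real N * \<pi> \<le> N" "real N * \<pi> \<ge> 0" using \<pi> by (simp_all add: mult_left_le)
      ultimately have "\<bar>?S - N * \<pi>\<bar> \<le> N" by (simp add: abs_le_iff)
      moreover have "?F \<omega> = ?S - N * \<pi>" using True by (simp add: indicator_def)
      moreover have "real N * \<epsilon> \<ge> 0" using \<epsilon> by simp
      ultimately show ?thesis using freq[of \<omega>] True by (cases "\<omega> \<in> D") (auto simp: indicator_def)
    qed simp
  qed (use iF in auto)
  also have "\<dots> = N * (\<epsilon> * prob A + prob (A \<inter> D))"
    using A D by (subst Bochner_Integration.integral_add) (auto intro!: int simp: algebra_simps)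
  finally show ?thesis using N by simp
qed

text \<open>Indicators take values in [0, 1] whatever B and P are, so the bound is uniform in both.
  This is what allows the set and the tilted law to change with n.\<close>

lemma Hoeffding_frequency_PiM:
  fixes P :: "real measure"
  assumes P: "prob_space P" and sP[measurable_cong]: "sets P = sets borel" and B[measurable]: "B \<in> sets borel"
    and N: "N > (0::nat)" and \<epsilon>: "\<epsilon> \<ge> 0"
  shows "measure (PiM {1..N} (\<lambda>_. P)) {\<omega> \<in> space (PiM {1..N} (\<lambda>_. P)).
      N * \<epsilon> \<le> \<bar>(\<Sum>i=1..N. indicator B (\<omega> i)) - N * measure P B\<bar>} \<le> 2 * exp (- 2 * real N * \<epsilon>\<^sup>2)"
proof -
  let ?Q = "PiM {1..N} (\<lambda>_. P)"
  interpret Q: prob_space ?Q by (intro prob_space_PiM P)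
  have ind: "Q.indep_vars (\<lambda>_. borel) (\<lambda>i \<omega>. \<omega> i) {1..N}"
    using N by (intro indep_vars_PiM_coordinates P sP) (simp add: Suc_le_eq)
  have e: "Q.expectation (\<lambda>\<omega>. indicator B (\<omega> i)) = measure P B" if "i \<in> {1..N}" for i
  proof -
    have "Q.expectation (\<lambda>\<omega>. indicator B (\<omega> i)) = (\<integral>x. (indicator B x :: real) \<partial>distr ?Q P (\<lambda>\<omega>. \<omega> i))"
      using that by (subst integral_distr) (auto simp: sP)
    also have "distr ?Q P (\<lambda>\<omega>. \<omega> i) = P" by (rule distr_PiM_component) (use P that in auto)
    finally show ?thesis using sets_eq_imp_space_eq[OF sP] by simp
  qed
  interpret H: Hoeffding_ineq ?Q "{1..N}" "\<lambda>i \<omega>. indicator B (\<omega> i)" "\<lambda>_. 0" "\<lambda>_. 1" "N * measure P B"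
  proof unfold_locales
    show "Q.indep_vars (\<lambda>_. borel) (\<lambda>i \<omega>. indicator B (\<omega> i)) {1..N}"
      by (rule Q.indep_vars_compose2[OF ind]) auto
    show "real N * measure P B \<equiv> \<Sum>i = 1..N. Q.expectation (\<lambda>\<omega>. indicator B (\<omega> i))"
      using e by (intro eq_reflection) simp
  qed (auto simp: indicator_def)
  have "(N * \<epsilon>)\<^sup>2 / N = N * \<epsilon>\<^sup>2" using N by (simp add: power2_eq_square field_simps)
  then have "- 2 * (real N * \<epsilon>)\<^sup>2 / N = - 2 * real N * \<epsilon>\<^sup>2" by simp
  then show ?thesis using H.Hoeffding_ineq_abs_ge[of "N * \<epsilon>"] N \<epsilon> by simp
qed

lemma prob_PiM_sum_near_mean_ge:
  fixes P :: "real measure"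
  assumes P: "prob_space P" and sP[measurable_cong]: "sets P = sets borel"
    and int: "integrable P (\<lambda>x. x)" and mean: "(\<integral>x. x \<partial>P) = a"
    and int2: "integrable P (\<lambda>x. (x - a)\<^sup>2)" and var: "(\<integral>x. (x - a)\<^sup>2 \<partial>P) \<le> V * \<sigma>\<^sup>2"
    and \<kappa>: "\<kappa> \<le> measure P {a - \<sigma>..a - \<sigma>/2}" "\<kappa> \<le> measure P {a + \<sigma>/2..a + \<sigma>}" "\<kappa> \<ge> 0"
    and \<sigma>: "\<sigma> > 0" and V: "V \<ge> 0" and m: "m \<le> N" "8 * V * real N \<le> (real m)\<^sup>2" and N: "N > 0"
  shows "\<kappa> ^ m / 2 \<le> measure (PiM {1..N} (\<lambda>_. P)) {\<omega> \<in> space (PiM {1..N} (\<lambda>_. P)). \<bar>\<Sum>i=1..N. \<omega> i - a\<bar> \<le> \<sigma>}"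
proof -
  let ?Q = "PiM {1..N} (\<lambda>_. P)"
  interpret P: prob_space P by (rule P)
  interpret Q: prob_space ?Q by (intro prob_space_PiM P)
  have D: "distr ?Q P (\<lambda>\<omega>. \<omega> i) = P" if "i \<in> {1..N}" for i
    by (rule distr_PiM_component) (use P that in auto)
  have meas: "(\<lambda>\<omega>. \<omega> i) \<in> measurable ?Q P" if "i \<in> {1..N}" for i
    using that by (rule measurable_component_singleton)
  have ie: "integrable ?Q (\<lambda>\<omega>. f (\<omega> i)) \<longleftrightarrow> integrable P f" "Q.expectation (\<lambda>\<omega>. f (\<omega> i)) = (\<integral>x. f x \<partial>P)"
    if "i \<in> {1..N}" and [measurable]: "f \<in> borel_measurable borel" for i and f :: "real \<Rightarrow> real"
    using integrable_distr_eq[OF meas[OF that(1)], of f] integral_distr[OF meas[OF that(1)], of f] D[OF that(1)] by auto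
  have pr: "Q.prob {\<omega> \<in> space ?Q. \<omega> i \<in> A} = measure P A" if "i \<in> {1..N}" "A \<in> sets borel" for i A
    using measure_distr[OF meas[OF that(1)], of A] D[OF that(1)] that(2) sP by (simp add: vimage_def Int_def conj_commute)
  show ?thesis
  proof (rule Q.prob_sum_near_zero_ge[where V = V])
    show "Q.indep_vars (\<lambda>_. borel) (\<lambda>i \<omega>. \<omega> i - a) {1..N}"
    proof (rule Q.indep_vars_compose2[where Y = "\<lambda>_ x. x - a"])
      show "Q.indep_vars (\<lambda>_. borel) (\<lambda>i \<omega>. \<omega> i) {1..N}"
        using N by (intro indep_vars_PiM_coordinates P sP) (simp add: Suc_le_eq)
    qed simp
    fix i assume i: "i \<in> {1..N}"
    have int1: "integrable P (\<lambda>x. x - a)" by (intro Bochner_Integration.integrable_diff int) simp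
    show "integrable ?Q (\<lambda>\<omega>. \<omega> i - a)"
      by (rule iffD2[OF ie(1)[OF i] int1]) measurable
    have "Q.expectation (\<lambda>\<omega>. \<omega> i - a) = (\<integral>x. x - a \<partial>P)"
      by (rule ie(2)[OF i]) measurable
    then show "Q.expectation (\<lambda>\<omega>. \<omega> i - a) = 0"
      using int mean by (simp add: P.prob_space)
    show "integrable ?Q (\<lambda>\<omega>. (\<omega> i - a)\<^sup>2)"
      by (rule iffD2[OF ie(1)[OF i] int2]) measurable
    have "Q.expectation (\<lambda>\<omega>. (\<omega> i - a)\<^sup>2) = (\<integral>x. (x - a)\<^sup>2 \<partial>P)"
      by (rule ie(2)[OF i]) measurable
    then show "Q.expectation (\<lambda>\<omega>. (\<omega> i - a)\<^sup>2) \<le> V * \<sigma>\<^sup>2" using var by simp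
    have "{\<omega> \<in> space ?Q. - \<sigma> \<le> \<omega> i - a \<and> \<omega> i - a \<le> - \<sigma>/2} = {\<omega> \<in> space ?Q. \<omega> i \<in> {a - \<sigma>..a - \<sigma>/2}}" by auto
    then show "\<kappa> \<le> Q.prob {\<omega> \<in> space ?Q. - \<sigma> \<le> \<omega> i - a \<and> \<omega> i - a \<le> - \<sigma>/2}"
      using \<kappa>(1) pr[OF i, of "{a - \<sigma>..a - \<sigma>/2}"] by simp
    have "{\<omega> \<in> space ?Q. \<sigma>/2 \<le> \<omega> i - a \<and> \<omega> i - a \<le> \<sigma>} = {\<omega> \<in> space ?Q. \<omega> i \<in> {a + \<sigma>/2..a + \<sigma>}}" by auto
    then show "\<kappa> \<le> Q.prob {\<omega> \<in> space ?Q. \<sigma>/2 \<le> \<omega> i - a \<and> \<omega> i - a \<le> \<sigma>}"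
      using \<kappa>(2) pr[OF i, of "{a + \<sigma>/2..a + \<sigma>}"] by simp
  qed (use \<sigma> \<kappa> V m in auto)
qed

text \<open>The exceptional event \<open>D\<close> involves only the first \<open>N\<close> of the \<open>N + 1\<close> summands. Integrating out the last
  one produces the same factor $\phi^N e^{-tb}$ in numerator and denominator, so it cancels; this
  is why no relation between \<open>t\<close> and \<open>N\<close> is needed.\<close>

lemma conditioned_coordinate_tilted_bound:
  fixes P :: "real measure" and t \<phi> :: real
  defines "G \<equiv> density P (\<lambda>x. ennreal (exp (t * x) / \<phi>))"
  assumes P: "prob_space P" "prob_space G" and sP[measurable_cong]: "sets P = sets borel" and \<phi>: "\<phi> > 0"
    and B[measurable]: "B \<in> sets borel"
    and int: "integrable G (\<lambda>x. x)" and mean: "(\<integral>x. x \<partial>G) = a"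
    and int2: "integrable G (\<lambda>x. (x - a)\<^sup>2)" and var: "(\<integral>x. (x - a)\<^sup>2 \<partial>G) \<le> V * \<sigma>\<^sup>2"
    and \<kappa>: "\<kappa> \<le> measure G {a - \<sigma>..a - \<sigma>/2}" "\<kappa> \<le> measure G {a + \<sigma>/2..a + \<sigma>}" "\<kappa> > 0"
    and U: "\<And>s. emeasure P {s..} \<le> ennreal (U * exp (- t * s))" "U \<ge> 0"
    and L: "\<And>s. \<bar>s - a\<bar> \<le> \<sigma> \<Longrightarrow> ennreal (L * exp (- t * s)) \<le> emeasure P {s..}" "L > 0"
    and \<sigma>: "\<sigma> > 0" and V: "V \<ge> 0" and m: "m \<le> N" "8 * V * real N \<le> (real m)\<^sup>2" and N: "N > 0" and \<epsilon>: "\<epsilon> \<ge> 0"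
  defines "Q \<equiv> PiM {1..Suc N} (\<lambda>_. P)"
  shows "\<bar>measure Q {\<omega> \<in> space Q. \<omega> 1 \<in> B \<and> real (Suc N) * a \<le> (\<Sum>i=1..Suc N. \<omega> i)}
         / measure Q {\<omega> \<in> space Q. real (Suc N) * a \<le> (\<Sum>i=1..Suc N. \<omega> i)} - measure G B\<bar>
         \<le> \<epsilon> + 4 * (U / L) * exp (- 2 * real N * \<epsilon>\<^sup>2) / \<kappa> ^ m"
proof -
  interpret P: prob_space P by (rule P)
  interpret G: prob_space G by (rule P)
  interpret Q: prob_space Q unfolding Q_def by (intro prob_space_PiM P)
  let ?R = "PiM {1..N} (\<lambda>_. G)"
  interpret R: prob_space ?R by (intro prob_space_PiM P)
  have sG[measurable_cong]: "sets G = sets borel" by (simp add: G_def sP)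
  have sR: "sets ?R = sets (PiM {1..N} (\<lambda>_. P))" by (intro sets_PiM_cong) (auto simp: G_def)
  have spR: "space ?R = space (PiM {1..N} (\<lambda>_. P))" by (intro sets_eq_imp_space_eq sR)
  define b where "b = real (Suc N) * a"
  define D where "D = {\<omega> \<in> space ?R. N * \<epsilon> \<le> \<bar>(\<Sum>i=1..N. indicator B (\<omega> i)) - N * measure G B\<bar>}"
  define A where "A = {\<omega> \<in> space Q. b \<le> (\<Sum>i=1..Suc N. \<omega> i)}"
  define D' where "D' = {\<omega> \<in> space Q. restrict \<omega> {1..N} \<in> D}"
  define c where "c = exp (- t * b) * \<phi> ^ N"
  have c: "c > 0" using \<phi> by (simp add: c_def)
  have "D \<in> sets ?R" unfolding D_def by measurable
  then have D: "D \<in> sets (PiM {1..N} (\<lambda>_. P))" by (simp only: sR)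
  have PP: "prob_space (density P (\<lambda>x. ennreal (exp (t * x) / \<phi>)))" using P(2) by (simp add: G_def)
  have "Q.prob (A \<inter> D') \<le> U * c * R.prob D"
  proof -
    have "A \<inter> D' = {\<omega> \<in> space Q. restrict \<omega> {1..N} \<in> D \<and> b \<le> (\<Sum>i=1..Suc N. \<omega> i)}"
      by (auto simp: A_def D'_def)
    then have "ennreal (Q.prob (A \<inter> D')) \<le> ennreal (U * exp (- t * b) * \<phi> ^ N) * ennreal (R.prob D)"
      using emeasure_tail_event_le[OF P(1) PP sP \<phi> D U, of b]
      unfolding G_def[symmetric] Q_def[symmetric]
      by (simp only: Q.emeasure_eq_measure R.emeasure_eq_measure)
    then have "ennreal (Q.prob (A \<inter> D')) \<le> ennreal (U * c * R.prob D)"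
      using U(2) c by (simp add: c_def ennreal_mult'[symmetric] mult.assoc)
    then show ?thesis using U(2) c by (subst (asm) ennreal_le_iff) auto
  qed
  also have "\<dots> \<le> U * c * (2 * exp (- 2 * real N * \<epsilon>\<^sup>2))"
    unfolding D_def using U(2) c Hoeffding_frequency_PiM[OF P(2) sG B N \<epsilon>] by (intro mult_left_mono) auto
  finally have AD: "Q.prob (A \<inter> D') \<le> U * c * (2 * exp (- 2 * real N * \<epsilon>\<^sup>2))" .
  have pA: "L * c * (\<kappa> ^ m / 2) \<le> Q.prob A"
  proof -
    let ?G = "{\<omega> \<in> space ?R. \<bar>\<Sum>i=1..N. \<omega> i - a\<bar> \<le> \<sigma>}"
    have "ennreal (L * exp (- t * b) * \<phi> ^ N) * ennreal (R.prob ?G) \<le> ennreal (Q.prob A)"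
      using emeasure_tail_event_ge[where a = a and \<sigma> = \<sigma> and N = N, OF P(1) PP sP \<phi> L(1)] L(2)
      unfolding G_def[symmetric] Q_def[symmetric] A_def b_def[symmetric] spR[symmetric]
      by (simp only: Q.emeasure_eq_measure R.emeasure_eq_measure)
    then have "ennreal (L * c * R.prob ?G) \<le> ennreal (Q.prob A)"
      using L(2) c by (simp add: c_def ennreal_mult'[symmetric] mult.assoc)
    then have "L * c * R.prob ?G \<le> Q.prob A" by (subst (asm) ennreal_le_iff) auto
    moreover have "L * c * (\<kappa> ^ m / 2) \<le> L * c * R.prob ?G"
      using L(2) c prob_PiM_sum_near_mean_ge[OF P(2) sG int mean int2 var \<kappa>(1,2) _ \<sigma> V m N] \<kappa>(3)
      by (intro mult_left_mono) auto
    ultimately show ?thesis by linarith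
  qed
  have pos: "Q.prob A > 0" using less_le_trans[OF _ pA, of 0] L(2) c \<kappa>(3) by simp
  have Am: "A \<in> sets Q" unfolding A_def Q_def by measurable
  have r: "(\<lambda>\<omega>. restrict \<omega> {1..N}) \<in> measurable Q (PiM {1..N} (\<lambda>_. P))"
    unfolding Q_def by (intro measurable_restrict_subset) auto
  have "D' = (\<lambda>\<omega>. restrict \<omega> {1..N}) -` D \<inter> space Q" by (auto simp: D'_def)
  then have D'm: "D' \<in> sets Q" using measurable_sets[OF r D] by simp
  define E where "E i = {\<omega> \<in> space Q. \<omega> i \<in> B}" for i :: nat
  have Em: "E i \<in> sets Q" if "i \<in> {1..Suc N}" for i
  proof -
    have "E i = (\<lambda>\<omega>. \<omega> i) -` B \<inter> space Q" by (auto simp: E_def)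
    then show ?thesis
      unfolding Q_def using that B sP by (auto intro!: measurable_sets[OF measurable_component_singleton])
  qed
  have EA: "E i \<inter> A = {\<omega> \<in> space Q. \<omega> i \<in> B \<and> b \<le> (\<Sum>i=1..Suc N. \<omega> i)}" for i
    by (auto simp: E_def A_def)
  have "\<bar>Q.prob (E 1 \<inter> A) - measure G B * Q.prob A\<bar> \<le> \<epsilon> * Q.prob A + Q.prob (A \<inter> D')"
  proof (rule Q.exchangeable_frequency_bound[OF Am D'm])
    show "E i \<in> Q.events" if "i \<in> {1..N}" for i using that by (intro Em) auto
    show "Q.prob (E i \<inter> A) = Q.prob (E 1 \<inter> A)" if "i \<in> {1..N}" for i
      unfolding EA Q_def by (rule measure_PiM_swap[OF P(1) sP B]) (use that in auto)
    fix \<omega> assume \<omega>: "\<omega> \<in> A - D'"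
    then have "restrict \<omega> {1..N} \<in> space ?R"
      unfolding A_def spR using measurable_space[OF r] by auto
    moreover have "\<omega> \<in> space Q" using \<omega> by (auto simp: A_def)
    moreover have "(\<Sum>i=1..N. indicator (E i) \<omega>) = (\<Sum>i=1..N. indicator B (restrict \<omega> {1..N} i) :: real)"
      using \<open>\<omega> \<in> space Q\<close> by (intro sum.cong) (auto simp: E_def indicator_def)
    moreover have "restrict \<omega> {1..N} \<notin> D" using \<omega> \<open>\<omega> \<in> space Q\<close> by (simp add: D'_def)
    ultimately show "\<bar>(\<Sum>i=1..N. indicator (E i) \<omega>) - N * measure G B\<bar> \<le> N * \<epsilon>"
      by (simp add: D_def)
  qed (use N \<epsilon> in auto)
  then have "\<bar>Q.prob (E 1 \<inter> A) - measure G B * Q.prob A\<bar> / Q.prob A \<le> \<epsilon> + Q.prob (A \<inter> D') / Q.prob A"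
    using pos by (simp add: divide_le_eq distrib_right)
  also have "\<bar>Q.prob (E 1 \<inter> A) - measure G B * Q.prob A\<bar> / Q.prob A = \<bar>Q.prob (E 1 \<inter> A) / Q.prob A - measure G B\<bar>"
    using pos by (simp add: abs_div_pos diff_divide_distrib)
  \<comment> \<open>The 4 collects the 2 of the two-sided Hoeffding bound and the 1/2 that Chebyshev
    leaves in the denominator.\<close>
  also have "Q.prob (A \<inter> D') / Q.prob A \<le> (U * c * (2 * exp (- 2 * real N * \<epsilon>\<^sup>2))) / (L * c * (\<kappa> ^ m / 2))"
    using AD pA pos L(2) c \<kappa>(3) U(2) by (intro frac_le) auto
  also have "\<dots> = 4 * (U / L) * exp (- 2 * real N * \<epsilon>\<^sup>2) / \<kappa> ^ m"
    using c by simp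
  finally show ?thesis unfolding EA unfolding A_def b_def by simp
qed

section \<open>Laplace bounds for the tilted density\<close>

text \<open>The logarithmic derivative of x^\<beta> exp (integral of \<epsilon>(u)/u) is (\<beta> +
  \<epsilon>(x)) / x. As \<epsilon> tends to 0, x h'(x) / h(x) eventually lies between \<beta>/2 and
  2\<beta>.\<close>

lemma in_R_derivative_bounds:
  assumes R: "in_R \<beta> h" and \<beta>: "\<beta> > 0"
  obtains x0 h' where "x0 \<ge> 1" "\<And>x. x \<ge> x0 \<Longrightarrow> h x > 0"
    "\<And>x. x \<ge> x0 \<Longrightarrow> (h has_real_derivative h' x) (at x)"
    "\<And>x. x \<ge> x0 \<Longrightarrow> \<beta> / 2 * (h x / x) \<le> h' x" "\<And>x. x \<ge> x0 \<Longrightarrow> h' x \<le> 2 * \<beta> * (h x / x)"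
proof -
  from R obtain l \<epsilon> where
    d\<epsilon>: "\<And>x. x \<ge> 1 \<Longrightarrow> \<epsilon> differentiable (at x)" and \<epsilon>0: "(\<epsilon> \<longlongrightarrow> 0) at_top" and
    l: "\<And>x. x \<ge> 1 \<Longrightarrow> l x = exp (LBINT u=1..x. \<epsilon> u / u)" and
    ev: "\<forall>\<^sub>F x in at_top. h x = x powr \<beta> * l x"
    unfolding in_R_def by blast
  from \<epsilon>0 have "\<forall>\<^sub>F x in at_top. dist (\<epsilon> x) 0 < \<beta> / 2"
    using \<beta> by (intro tendstoD) auto
  with ev have "\<forall>\<^sub>F x in at_top. h x = x powr \<beta> * l x \<and> \<bar>\<epsilon> x\<bar> < \<beta> / 2"
    by eventually_elim auto
  then obtain X where X: "\<And>x. x \<ge> X \<Longrightarrow> h x = x powr \<beta> * l x" "\<And>x. x \<ge> X \<Longrightarrow> \<bar>\<epsilon> x\<bar> < \<beta> / 2"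
    unfolding eventually_at_top_linorder by blast
  define F where "F = (\<lambda>x::real. LBINT u=1..x. \<epsilon> u / u)"
  have F: "(F has_real_derivative \<epsilon> x / x) (at x)" if "x > 1" for x
  proof -
    have "continuous_on {1..x+1} (\<lambda>u. \<epsilon> u / u)"
      using d\<epsilon> by (intro continuous_intros continuous_at_imp_continuous_on ballI differentiable_imp_continuous_within) auto
    then have "(F has_vector_derivative \<epsilon> x / x) (at x within {1..x+1})"
      unfolding F_def using that by (intro interval_integral_FTC2[of 1 1 "x+1" "\<lambda>u. \<epsilon> u / u" x, unfolded one_ereal_def[symmetric]]) auto
    moreover have "at x within {1..x+1} = at x" using that by (intro at_within_interior) auto
    ultimately show ?thesis by (simp add: has_real_derivative_iff_has_vector_derivative)
  qed
  \<comment> \<open>The added 1 leaves room on the left: the integral is differentiated at points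
    above 1, and the formula for h must hold on a neighbourhood for its derivative to carry
    over.\<close>
  define x0 where "x0 = max X 1 + 1"
  have heq: "h x = x powr \<beta> * exp (F x)" if "x > max X 1" for x
    using X(1)[of x] l[of x] that by (simp add: F_def)
  define h' where "h' = (\<lambda>x. (\<beta> + \<epsilon> x) * (h x / x))"
  have hpos: "h x > 0" if "x \<ge> x0" for x
  proof -
    have "x > max X 1" "x > 0" using that by (auto simp: x0_def)
    then show ?thesis using heq[of x] by simp
  qed
  show ?thesis
  proof
    show "x0 \<ge> 1" by (simp add: x0_def)
    fix x assume x: "x \<ge> x0"
    then have x1: "x > max X 1" "x > 1" "x > 0" by (auto simp: x0_def)
    show "h x > 0" by (rule hpos[OF x])
    have "((\<lambda>x. x powr \<beta> * exp (F x)) has_real_derivative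
        \<beta> * x powr (\<beta> - 1) * exp (F x) + x powr \<beta> * (exp (F x) * (\<epsilon> x / x))) (at x)"
      using x1 F[OF x1(2)] by (auto intro!: derivative_eq_intros simp: powr_diff)
    also have "\<beta> * x powr (\<beta> - 1) * exp (F x) + x powr \<beta> * (exp (F x) * (\<epsilon> x / x)) = h' x"
      using x1 by (simp add: h'_def heq[OF x1(1)] powr_diff field_simps)
    finally have d: "((\<lambda>x. x powr \<beta> * exp (F x)) has_real_derivative h' x) (at x)" .
    show "(h has_real_derivative h' x) (at x)"
      by (rule has_field_derivative_transform_within_open[OF d, of "{max X 1<..}"]) (use x1 heq in auto)
    have "\<bar>\<epsilon> x\<bar> < \<beta> / 2" using X(2)[of x] x1 by simp
    then have "\<beta> / 2 \<le> \<beta> + \<epsilon> x" "\<beta> + \<epsilon> x \<le> 2 * \<beta>" by linarith+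
    moreover have "h x / x \<ge> 0" using hpos[OF x] x1 by simp
    ultimately show "\<beta> / 2 * (h x / x) \<le> h' x" "h' x \<le> 2 * \<beta> * (h x / x)"
      unfolding h'_def by (blast intro: mult_right_mono)+
  qed
qed

text \<open>The differential inequalities say that h(x) x^(-b) is nondecreasing and h(x) x^(-B)
  nonincreasing; comparing their values at x and y gives both bounds.\<close>

lemma powr_growth_bounds:
  fixes h h' :: "real \<Rightarrow> real"
  assumes x0: "x0 \<ge> 1"
    and d: "\<And>x. x \<ge> x0 \<Longrightarrow> (h has_real_derivative h' x) (at x)"
    and lo: "\<And>x. x \<ge> x0 \<Longrightarrow> b * (h x / x) \<le> h' x" and up: "\<And>x. x \<ge> x0 \<Longrightarrow> h' x \<le> B * (h x / x)"
    and xy: "x0 \<le> x" "x \<le> y"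
  shows "h x * (y / x) powr b \<le> h y" "h y \<le> h x * (y / x) powr B"
proof -
  have x: "x > 0" "y > 0" using x0 xy by auto
  have der: "((\<lambda>x. h x * x powr (-b)) has_real_derivative (h' u - b * (h u / u)) * u powr (-b)) (at u)"
    if "u \<ge> x0" for u b
  proof -
    have u: "u > 0" using that x0 by simp
    show ?thesis
      by (rule DERIV_cong[OF DERIV_mult[OF d[OF that] has_real_derivative_powr[OF u]]])
        (use u in \<open>simp add: powr_diff field_simps\<close>)
  qed
  have "h x * x powr (-b) \<le> h y * y powr (-b)"
  proof (rule DERIV_nonneg_imp_nondecreasing[OF xy(2)])
    fix u assume "x \<le> u" "u \<le> y"
    then have u: "u \<ge> x0" using xy by simp
    show "\<exists>v. ((\<lambda>x. h x * x powr (-b)) has_real_derivative v) (at u) \<and> 0 \<le> v"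
      using der[OF u, of b] lo[OF u] by (blast intro: mult_nonneg_nonneg diff_ge_0_iff_ge[THEN iffD2] powr_ge_zero)
  qed
  then show "h x * (y / x) powr b \<le> h y"
    using x by (simp add: powr_minus powr_divide field_simps)
  have "h y * y powr (-B) \<le> h x * x powr (-B)"
  proof (rule DERIV_nonpos_imp_nonincreasing[OF xy(2)])
    fix u assume "x \<le> u" "u \<le> y"
    then have u: "u \<ge> x0" using xy by simp
    show "\<exists>v. ((\<lambda>x. h x * x powr (-B)) has_real_derivative v) (at u) \<and> v \<le> 0"
      using der[OF u, of B] up[OF u] by (blast intro: mult_nonpos_nonneg diff_le_0_iff_le[THEN iffD2] powr_ge_zero)
  qed
  then show "h y \<le> h x * (y / x) powr B"
    using x by (simp add: powr_minus powr_divide field_simps)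
qed

text \<open>Since k(x) + m x is nonincreasing and k vanishes at z, K(x) + m/2 (x - z)^2 increases up
  to z and decreases after it. The sign of m is free on purpose: applied to -K with a negative m,
  the lemma bounds K from below.\<close>

lemma second_order_bound_at_critical_point:
  fixes K k :: "real \<Rightarrow> real"
  assumes d1: "\<And>x. x \<in> {l..u} \<Longrightarrow> (K has_real_derivative k x) (at x)"
    and d2: "\<And>x. x \<in> {l..u} \<Longrightarrow> \<exists>d\<le>-m. (k has_real_derivative d) (at x)"
    and z: "z \<in> {l..u}" "k z = 0" and x: "x \<in> {l..u}"
  shows "K x \<le> K z - m / 2 * (x - z)\<^sup>2"
proof -
  have kmono: "k y + m * y \<le> k w + m * w" if "w \<in> {l..u}" "y \<in> {l..u}" "w \<le> y" for w y
  proof (rule DERIV_nonpos_imp_nonincreasing[OF that(3)])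
    fix v assume "w \<le> v" "v \<le> y"
    then have "v \<in> {l..u}" using that by auto
    from d2[OF this] obtain e where "e \<le> -m" "(k has_real_derivative e) (at v)" by blast
    then show "\<exists>y. ((\<lambda>a. k a + m * a) has_real_derivative y) (at v) \<and> y \<le> 0"
      by (intro exI[of _ "e + m"]) (auto intro!: derivative_eq_intros)
  qed
  let ?H = "\<lambda>x. K x + m / 2 * (x - z)\<^sup>2"
  have dH: "(?H has_real_derivative k v + m * (v - z)) (at v)" if "v \<in> {l..u}" for v
    using d1[OF that] by (auto intro!: derivative_eq_intros)
  show ?thesis
  proof (cases "x \<le> z")
    case True
    have "?H x \<le> ?H z"
    proof (rule DERIV_nonneg_imp_nondecreasing[OF True])
      fix v assume v: "x \<le> v" "v \<le> z"
      then have "v \<in> {l..u}" using x z by auto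
      then show "\<exists>y. (?H has_real_derivative y) (at v) \<and> 0 \<le> y"
        using dH kmono[of v z] v z by (intro exI[of _ "k v + m * (v - z)"] conjI) (auto simp: right_diff_distrib)
    qed
    then show ?thesis by simp
  next
    case False
    then have zx: "z \<le> x" by simp
    have "?H x \<le> ?H z"
    proof (rule DERIV_nonpos_imp_nonincreasing[OF zx])
      fix v assume v: "z \<le> v" "v \<le> x"
      then have "v \<in> {l..u}" using x z by auto
      then show "\<exists>y. (?H has_real_derivative y) (at v) \<and> y \<le> 0"
        using dH kmono[of z v] v z by (intro exI[of _ "k v + m * (v - z)"] conjI) (auto simp: right_diff_distrib)
    qed
    then show ?thesis by simp
  qed
qed

text \<open>K has derivative t - h and so is critical at z. On [z/2, 2z] one doubling changes h by a
  factor of at most 2^(2\<beta>), so h lies between 2^(-2\<beta>) t and 2^(2\<beta>) t. Inserting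
  this, with z/2 <= x <= 2z, into the bounds for h' gives m t/z <= h' <= B t/z, which is where m and
  B come from. The assumption \<open>z \<ge> 2 * x0\<close> keeps z/2 in the range of these
  bounds.\<close>

lemma exponent_bounds_at_saddle:
  fixes g h h' :: "real \<Rightarrow> real" and t z \<beta> :: real
  assumes x0: "x0 \<ge> 1" and \<beta>: "\<beta> > 0" and pos: "\<And>x. x \<ge> x0 \<Longrightarrow> h x > 0"
    and d: "\<And>x. x \<ge> x0 \<Longrightarrow> (h has_real_derivative h' x) (at x)"
    and lo: "\<And>x. x \<ge> x0 \<Longrightarrow> \<beta> / 2 * (h x / x) \<le> h' x" and up: "\<And>x. x \<ge> x0 \<Longrightarrow> h' x \<le> 2 * \<beta> * (h x / x)"
    and g: "\<And>x. x \<ge> x0 \<Longrightarrow> (g has_real_derivative h x) (at x)"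
    and z: "z \<ge> 2 * x0" "h z = t"
  defines "K \<equiv> \<lambda>x. t * x - g x" and "m \<equiv> \<beta> / 4 * 2 powr (- 2 * \<beta>)" and "B \<equiv> 4 * \<beta> * 2 powr (2 * \<beta>)"
  shows "\<And>x. x \<in> {z/2..2*z} \<Longrightarrow> K x \<le> K z - m / 2 * (t / z) * (x - z)\<^sup>2"
    and "\<And>x. x \<in> {z/2..2*z} \<Longrightarrow> K x \<ge> K z - B / 2 * (t / z) * (x - z)\<^sup>2"
    and "\<And>x. x \<in> {x0..z/2} \<Longrightarrow> K x \<le> K z - m / 8 * (t * z)"
    and "\<And>x. x \<ge> 2 * z \<Longrightarrow> K x \<le> K z - m / 2 * (t * (x - z))"
proof -
  have z0: "z > 0" "z / 2 \<ge> x0" "z \<ge> x0" using z x0 by auto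
  have t: "t > 0" using pos z0 z by auto
  have m: "m > 0" using \<beta> by (simp add: m_def)
  have dK: "(K has_real_derivative t - h x) (at x)" if "x \<ge> x0" for x
    unfolding K_def using g[OF that] by (auto intro!: derivative_eq_intros)
  have dk: "((\<lambda>x. t - h x) has_real_derivative - h' x) (at x)" if "x \<ge> x0" for x
    using d[OF that] by (auto intro!: derivative_eq_intros)
  have mono: "h x \<le> h y" if "x0 \<le> x" "x \<le> y" for x y
  proof (rule DERIV_nonneg_imp_nondecreasing[OF that(2)])
    fix u assume "x \<le> u" "u \<le> y"
    then have u: "u \<ge> x0" using that by simp
    then have "0 \<le> \<beta> / 2 * (h u / u)" using pos[OF u] \<beta> x0 by auto
    then show "\<exists>v. (h has_real_derivative v) (at u) \<and> 0 \<le> v"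
      using d[OF u] lo[OF u] by (blast intro: order_trans)
  qed
  have growth: "h y \<le> h x * (y / x) powr (2 * \<beta>)" if "x0 \<le> x" "x \<le> y" for x y
    using powr_growth_bounds(2)[OF x0 d lo up that] by blast
  have h1: "t * 2 powr (- 2 * \<beta>) \<le> h x" "h x \<le> t * 2 powr (2 * \<beta>)" if "x \<in> {z/2..2*z}" for x
  proof -
    have "t \<le> h (z / 2) * (z / (z / 2)) powr (2 * \<beta>)" using growth[of "z/2" z] z z0 by simp
    also have "z / (z / 2) = 2" using z0 by simp
    finally have "t * 2 powr (- 2 * \<beta>) \<le> h (z / 2)" by (simp add: powr_minus field_simps)
    also have "\<dots> \<le> h x" using that z0 by (intro mono) auto
    finally show "t * 2 powr (- 2 * \<beta>) \<le> h x" .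
    have "h x \<le> h (2 * z)" using that z0 by (intro mono) auto
    also have "\<dots> \<le> h z * (2 * z / z) powr (2 * \<beta>)" using z0 by (intro growth) auto
    finally show "h x \<le> t * 2 powr (2 * \<beta>)" using z z0 by simp
  qed
  have h'1: "m * (t / z) \<le> h' x" "h' x \<le> B * (t / z)" if "x \<in> {z/2..2*z}" for x
  proof -
    have x: "x \<ge> x0" "x > 0" using that z0 by auto
    have "(t * 2 powr (- 2 * \<beta>)) / (2 * z) \<le> h x / x"
      using h1[OF that] that x pos[OF x(1)] by (intro frac_le) auto
    then have "\<beta> / 2 * ((t * 2 powr (- 2 * \<beta>)) / (2 * z)) \<le> \<beta> / 2 * (h x / x)"
      using \<beta> by (intro mult_left_mono) auto
    moreover have "m * (t / z) = \<beta> / 2 * ((t * 2 powr (- 2 * \<beta>)) / (2 * z))" by (simp add: m_def)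
    ultimately show "m * (t / z) \<le> h' x" using lo[OF x(1)] by linarith
    have "h x / x \<le> (t * 2 powr (2 * \<beta>)) / (z / 2)"
      using h1[OF that] that x pos[OF x(1)] z0 t by (intro frac_le) auto
    then have "2 * \<beta> * (h x / x) \<le> 2 * \<beta> * ((t * 2 powr (2 * \<beta>)) / (z / 2))"
      using \<beta> by (intro mult_left_mono) auto
    moreover have "B * (t / z) = 2 * \<beta> * ((t * 2 powr (2 * \<beta>)) / (z / 2))" by (simp add: B_def)
    ultimately show "h' x \<le> B * (t / z)" using up[OF x(1)] by linarith
  qed
  have ge: "x \<ge> x0" if "x \<in> {z/2..2*z}" for x using that z0 by auto
  show quad: "K x \<le> K z - m / 2 * (t / z) * (x - z)\<^sup>2" if x: "x \<in> {z/2..2*z}" for x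
  proof -
    have 2: "\<exists>d\<le>- (m * (t / z)). ((\<lambda>x. t - h x) has_real_derivative d) (at v)" if "v \<in> {z/2..2*z}" for v
      using dk[OF ge[OF that]] h'1(1)[OF that] by (intro exI[of _ "- h' v"]) auto
    have "K x \<le> K z - (m * (t / z)) / 2 * (x - z)\<^sup>2"
      by (rule second_order_bound_at_critical_point[OF dK[OF ge] 2 _ _ x]) (use z z0 in auto)
    then show ?thesis by simp
  qed
  show "K x \<ge> K z - B / 2 * (t / z) * (x - z)\<^sup>2" if x: "x \<in> {z/2..2*z}" for x
  proof -
    have 1: "((\<lambda>x. - K x) has_real_derivative - (t - h v)) (at v)" if "v \<in> {z/2..2*z}" for v
      using dK[OF ge[OF that]] by (rule DERIV_minus)
    have 2: "\<exists>d\<le>- (- B * (t / z)). ((\<lambda>x. - (t - h x)) has_real_derivative d) (at v)" if "v \<in> {z/2..2*z}" for v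
      using DERIV_minus[OF dk[OF ge[OF that]]] h'1(2)[OF that] by (intro exI[of _ "h' v"]) auto
    have "- K x \<le> - K z - (- B * (t / z)) / 2 * (x - z)\<^sup>2"
      by (rule second_order_bound_at_critical_point[OF 1 2 _ _ x]) (use z z0 in auto)
    then show ?thesis by simp
  qed
  show "K x \<le> K z - m / 8 * (t * z)" if x: "x \<in> {x0..z/2}" for x
  proof -
    \<comment> \<open>K increases as long as h stays below t, so on this range its value at z/2
      dominates, and there the quadratic loss is already m/8 t z.\<close>
    have "K x \<le> K (z / 2)"
    proof (rule DERIV_nonneg_imp_nondecreasing[where f = K])
      fix u assume u: "x \<le> u" "u \<le> z / 2"
      then have "h u \<le> h z" using x z0 by (intro mono) auto
      then show "\<exists>v. (K has_real_derivative v) (at u) \<and> 0 \<le> v"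
        using dK[of u] u x z by (intro exI[of _ "t - h u"]) auto
    qed (use x in auto)
    also have "\<dots> \<le> K z - m / 2 * (t / z) * (z / 2 - z)\<^sup>2" using z0 by (intro quad) auto
    also have "m / 2 * (t / z) * (z / 2 - z)\<^sup>2 = m / 8 * (t * z)"
      using z0 by (simp add: power2_eq_square field_simps)
    finally show ?thesis .
  qed
  show "K x \<le> K z - m / 2 * (t * (x - z))" if x: "x \<ge> 2 * z" for x
  proof -
    \<comment> \<open>From z to 2z the function h gains at least (m t/z) z = m t, and it does not
      lose this later; beyond 2z, K therefore falls at rate at least m t.\<close>
    have slope: "t - h u \<le> - m * t" if "u \<ge> 2 * z" for u
    proof -
      have "h z - m * (t / z) * z \<le> h (2 * z) - m * (t / z) * (2 * z)"
      proof (rule DERIV_nonneg_imp_nondecreasing[where f = "\<lambda>a. h a - m * (t / z) * a"])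
        fix v assume v: "z \<le> v" "v \<le> 2 * z"
        then show "\<exists>y. ((\<lambda>a. h a - m * (t / z) * a) has_real_derivative y) (at v) \<and> 0 \<le> y"
          using d[of v] h'1(1)[of v] z0 by (intro exI[of _ "h' v - m * (t / z)"]) (auto intro!: derivative_eq_intros)
      qed (use z0 in auto)
      then have "t + m * t \<le> h (2 * z)" using z z0 by (simp add: field_simps)
      moreover have "h (2 * z) \<le> h u" using that z0 by (intro mono) auto
      ultimately show ?thesis by simp
    qed
    have "K x + m * t * x \<le> K (2 * z) + m * t * (2 * z)"
    proof (rule DERIV_nonpos_imp_nonincreasing[where f = "\<lambda>a. K a + m * t * a", OF x])
      fix u assume u: "2 * z \<le> u" "u \<le> x"
      then show "\<exists>y. ((\<lambda>a. K a + m * t * a) has_real_derivative y) (at u) \<and> y \<le> 0"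
        using dK[of u] slope[OF u(1)] z0 by (intro exI[of _ "(t - h u) + m * t"]) (auto intro!: derivative_eq_intros)
    qed
    then have "K x + m * (t * x) \<le> K (2 * z) + 2 * (m * (t * z))" by (simp add: mult_ac)
    moreover have "K (2 * z) \<le> K z - m * (t * z) / 2"
    proof -
      have "K (2 * z) \<le> K z - m / 2 * (t / z) * (2 * z - z)\<^sup>2" using z0 by (intro quad) auto
      also have "m / 2 * (t / z) * (2 * z - z)\<^sup>2 = m * (t * z) / 2" using z0 by (simp add: power2_eq_square)
      finally show ?thesis .
    qed
    moreover have "m / 2 * (t * (x - z)) = m * (t * x) / 2 - m * (t * z) / 2" by (simp add: algebra_simps)
    \<comment> \<open>Half of the slope pays for measuring the distance from z instead of from 2z; x
      >= 2z makes this affordable.\<close>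
    moreover have "m * (t * x) \<ge> 2 * (m * (t * z))"
    proof -
      have "m * (t * (2 * z)) \<le> m * (t * x)" using m t x by (intro mult_left_mono) auto
      then show ?thesis by (simp add: mult_ac)
    qed
    ultimately show ?thesis by linarith
  qed
qed

text \<open>\<open>z\<close> is the saddle point $h(z) = t$, $\sigma = \sqrt{z/t}$ is comparable to the tilted standard
  deviation, and $E = e^{tz - g(z)}$.\<close>

definition laplace_envelope :: "(real \<Rightarrow> real) \<Rightarrow> real \<Rightarrow> real \<Rightarrow> real \<Rightarrow> real \<Rightarrow> real \<Rightarrow> bool" where
  "laplace_envelope p C \<mu> c' B t \<longleftrightarrow> (\<exists>z \<sigma> E. \<sigma> > 0 \<and> E > 0 \<and> (t * \<sigma>)\<^sup>2 \<ge> t \<and>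
       (\<forall>x. exp (t * x) * p x \<le> C * E * exp (- \<mu> * \<bar>(x - z) / \<sigma>\<bar>)) \<and>
       (\<forall>x. \<bar>(x - z) / \<sigma>\<bar> \<le> t * \<sigma> / 2 \<longrightarrow> c' * E * exp (- B * ((x - z) / \<sigma>)\<^sup>2) \<le> exp (t * x) * p x))"

text \<open>An exponential envelope in |x - z|/\<sigma> is weak enough to cover all regimes of the
  exponent: a quadratic loss near z, a loss of order t z to its left, a linear loss to its right.
  Bounding q by 1 costs factors e and 1/e. The constants depend on p alone, and only z, \<sigma> and
  E vary with t.\<close>

lemma laplace_envelope_exists:
  fixes p g q h h' :: "real \<Rightarrow> real" and \<beta> c P :: real
  assumes x0: "x0 \<ge> 1" and \<beta>: "\<beta> > 0" and pos: "\<And>x. x \<ge> x0 \<Longrightarrow> h x > 0"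
    and d: "\<And>x. x \<ge> x0 \<Longrightarrow> (h has_real_derivative h' x) (at x)"
    and lo: "\<And>x. x \<ge> x0 \<Longrightarrow> \<beta> / 2 * (h x / x) \<le> h' x" and up: "\<And>x. x \<ge> x0 \<Longrightarrow> h' x \<le> 2 * \<beta> * (h x / x)"
    and g: "\<And>x. x \<ge> x0 \<Longrightarrow> (g has_real_derivative h x) (at x)"
    and q: "\<And>x. x \<ge> x0 \<Longrightarrow> \<bar>q x\<bar> \<le> 1" and c: "c > 0"
    and p: "\<And>x. p x = (if 0 \<le> x then c * exp (- (g x - q x)) else 0)" and P: "\<And>x. p x \<le> P"
  obtains C c' \<mu> B T where "C > 0" "c' > 0" "\<mu> > 0" "T \<ge> 1"
    "\<And>t. t \<ge> T \<Longrightarrow> laplace_envelope p C \<mu> c' B t"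
proof -
  define m where "m = \<beta> / 4 * 2 powr (- 2 * \<beta>)"
  define B where "B = 4 * \<beta> * 2 powr (2 * \<beta>)"
  \<comment> \<open>The left range offers exactly the rate m/8; the other ranges have room for
    it.\<close>
  define \<mu> where "\<mu> = m / 8"
  define T where "T = max 1 (h (2 * x0))"
  \<comment> \<open>The first summand serves x >= x0. The second serves [0, x0), where p is only
    known to be bounded by P.\<close>
  define C where "C = c * exp 1 * exp \<mu> + P * exp (g x0)"
  have m: "m > 0" using \<beta> by (simp add: m_def)
  have pn: "p x \<ge> 0" for x using p c by simp
  have Pn: "P \<ge> 0" using pn P order_trans by blast
  show ?thesis
  proof
    show "C > 0" using c Pn by (auto simp: C_def intro!: add_pos_nonneg)
    show "c * exp (-1) > 0" using c by simp
    show "\<mu> > 0" using m by (simp add: \<mu>_def)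
    show "T \<ge> 1" by (simp add: T_def)
    fix t assume "t \<ge> T"
    then have t: "t \<ge> 1" "t \<ge> h (2 * x0)" by (auto simp: T_def)
    define b where "b = \<beta> / 2"
    \<comment> \<open>Beyond 2 x0, h grows at least like the power \<beta>/2, so stretching 2 x0 by
      (t / h(2 x0))^(2/\<beta>) is enough to reach t. The intermediate value theorem then supplies
      the saddle point.\<close>
    obtain y where y: "y \<ge> 2 * x0" "h y \<ge> t"
    proof
      let ?w = "(t / h (2 * x0)) powr (1 / b)"
      have h0: "h (2 * x0) > 0" using pos[of "2*x0"] x0 by simp
      have "?w \<ge> 1" using t h0 \<beta> by (intro ge_one_powr_ge_zero) (auto simp: b_def)
      then show w: "2 * x0 \<le> 2 * x0 * ?w" using x0 by simp
      have "h (2 * x0) * ((2 * x0 * ?w) / (2 * x0)) powr (\<beta> / 2) \<le> h (2 * x0 * ?w)"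
        using powr_growth_bounds(1)[OF x0 d lo up _ w] x0 by simp
      moreover have "((2 * x0 * ?w) / (2 * x0)) powr (\<beta> / 2) = t / h (2 * x0)"
        using x0 \<beta> t h0 by (simp add: powr_powr b_def)
      ultimately show "t \<le> h (2 * x0 * ?w)" using h0 by simp
    qed
    have "\<exists>z\<ge>2 * x0. z \<le> y \<and> h z = t"
      by (rule IVT) (use t y x0 d in \<open>auto intro!: DERIV_isCont[OF d]\<close>)
    then obtain z where z: "z \<ge> 2 * x0" "h z = t" by blast
    have bounds: "\<And>x. x \<in> {z/2..2*z} \<Longrightarrow> t * x - g x \<le> t * z - g z - m / 2 * (t / z) * (x - z)\<^sup>2"
      "\<And>x. x \<in> {z/2..2*z} \<Longrightarrow> t * x - g x \<ge> t * z - g z - B / 2 * (t / z) * (x - z)\<^sup>2"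
      "\<And>x. x \<in> {x0..z/2} \<Longrightarrow> t * x - g x \<le> t * z - g z - m / 8 * (t * z)"
      "\<And>x. x \<ge> 2 * z \<Longrightarrow> t * x - g x \<le> t * z - g z - m / 2 * (t * (x - z))"
      by (rule exponent_bounds_at_saddle[OF x0 \<beta> pos d lo up g z, folded m_def B_def], assumption+)+
    define \<sigma> where "\<sigma> = sqrt (z / t)"
    define E where "E = exp (t * z - g z)"
    \<comment> \<open>In units of \<sigma> the saddle lies at distance l from the origin: z = l
      \<sigma> and l^2 = t z. As l >= 1, distances up to l are bounded by t z, the size of the loss
      to the left of z.\<close>
    define l where "l = t * \<sigma>"
    have z1: "z \<ge> 2" using z x0 by simp
    have \<sigma>: "\<sigma> > 0" using z1 t by (simp add: \<sigma>_def)
    have \<sigma>2: "\<sigma>\<^sup>2 = z / t" using z1 t by (simp add: \<sigma>_def)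
    have l2: "l\<^sup>2 = t * z" using t by (simp only: l_def power_mult_distrib \<sigma>2) (simp add: power2_eq_square)
    have "l * \<sigma> = t * \<sigma>\<^sup>2" by (simp add: l_def power2_eq_square)
    then have l\<sigma>: "l * \<sigma> = z" using \<sigma>2 t by simp
    have "l\<^sup>2 \<ge> t * 1" unfolding l2 using z1 t by (intro mult_left_mono) auto
    then have lt: "l\<^sup>2 \<ge> t" by simp
    have l0: "l > 0" using t \<sigma> by (simp add: l_def)
    have l1: "l \<ge> 1" using power2_le_imp_le[of 1 l] lt t l0 by simp
    have ysq: "(t / z) * (x - z)\<^sup>2 = ((x - z) / \<sigma>)\<^sup>2" for x
      using t z1 by (simp add: power_divide \<sigma>2)
    have pbd: "c * exp (-1) * exp (- g x) \<le> p x" "p x \<le> c * exp 1 * exp (- g x)" if "x \<ge> x0" for x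
    proof -
      have "p x = c * exp (q x) * exp (- g x)" using p[of x] that x0 by (simp add: exp_diff exp_minus field_simps)
      moreover have "exp (-1) \<le> exp (q x)" "exp (q x) \<le> exp 1" using q[OF that] by auto
      ultimately show "c * exp (-1) * exp (- g x) \<le> p x" "p x \<le> c * exp 1 * exp (- g x)"
        using c by auto
    qed
    have large: "t * x - g x \<le> t * z - g z + \<mu> - \<mu> * \<bar>(x - z) / \<sigma>\<bar>" if x: "x \<ge> x0" for x
    proof -
      let ?y = "\<bar>(x - z) / \<sigma>\<bar>"
      consider "x \<le> z / 2" | "x \<in> {z/2..2*z}" | "x \<ge> 2 * z" by fastforce
      then show ?thesis
      proof cases
        case 1
        have "\<bar>x - z\<bar> \<le> l * \<sigma>" using 1 x x0 by (simp add: l\<sigma>)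
        then have "?y \<le> l" using \<sigma> by (simp add: divide_le_eq)
        also have "l \<le> l * l" using l1 by simp
        finally have "\<mu> * ?y \<le> \<mu> * (t * z)" using l2 m by (intro mult_left_mono) (auto simp: power2_eq_square \<mu>_def)
        then show ?thesis using bounds(3)[of x] 1 x m by (simp add: \<mu>_def)
      next
        case 2
        \<comment> \<open>A quadratic loss dominates a linear one only up to a constant; this
          constant is the \<open>+ \<mu>\<close> in \<open>large\<close> and the factor
          \<open>exp \<mu>\<close> in C.\<close>
        have "0 \<le> (?y - 1)\<^sup>2" by simp
        then have "2 * ?y - 1 \<le> ?y\<^sup>2" by (simp add: power2_diff)
        then have "?y - 1 \<le> 4 * ?y\<^sup>2" by (smt (verit) zero_le_power2)
        then have "m / 8 * (?y - 1) \<le> m / 8 * (4 * ?y\<^sup>2)" using m by (intro mult_left_mono) auto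
        moreover have "m / 2 * (t / z) * (x - z)\<^sup>2 = m / 8 * (4 * ?y\<^sup>2)"
        proof -
          have "?y\<^sup>2 = (t / z) * (x - z)\<^sup>2" by (simp only: power2_abs ysq)
          then show ?thesis by simp
        qed
        moreover have "m / 8 * (?y - 1) = \<mu> * ?y - \<mu>" by (simp add: \<mu>_def algebra_simps)
        ultimately show ?thesis using bounds(1)[OF 2] by linarith
      next
        case 3
        have "t * (x - z) = l * ((x - z) / \<sigma>)" using \<sigma> by (simp add: l_def)
        moreover have "1 * ((x - z) / \<sigma>) \<le> l * ((x - z) / \<sigma>)" using l1 3 \<sigma> z1 by (intro mult_right_mono) auto
        ultimately have "?y \<le> t * (x - z)" using 3 \<sigma> z1 by simp
        then have "m / 8 * ?y \<le> m / 2 * (t * (x - z))" using m 3 z1 t by (intro mult_mono) auto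
        then show ?thesis using bounds(4)[OF 3] m by (simp add: \<mu>_def)
      qed
    qed
    have U: "exp (t * x) * p x \<le> C * E * exp (- \<mu> * \<bar>(x - z) / \<sigma>\<bar>)" for x
    proof -
      let ?e = "E * exp (- \<mu> * \<bar>(x - z) / \<sigma>\<bar>)"
      have e: "?e = exp (t * z - g z - \<mu> * \<bar>(x - z) / \<sigma>\<bar>)" by (simp add: E_def mult_exp_exp)
      consider "x < 0" | "0 \<le> x" "x < x0" | "x \<ge> x0" by linarith
      then have "exp (t * x) * p x \<le> c * exp 1 * exp \<mu> * ?e \<or> exp (t * x) * p x \<le> P * exp (g x0) * ?e"
      proof cases
        case 1
        then show ?thesis using p[of x] c by (simp add: E_def)
      next
        case 2
        \<comment> \<open>Below x0 the comparison is with x0 itself: t x <= t x0, and the bound for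
          K at x0 gives the envelope up to the factor exp (g x0).\<close>
        have "\<bar>x - z\<bar> \<le> l * \<sigma>" using 2 z x0 by (simp add: l\<sigma>)
        then have "\<bar>(x - z) / \<sigma>\<bar> \<le> l" using \<sigma> by (simp add: divide_le_eq)
        also have "l \<le> l * l" using l1 by simp
        finally have "\<mu> * \<bar>(x - z) / \<sigma>\<bar> \<le> \<mu> * (t * z)"
          using l2 m by (intro mult_left_mono) (auto simp: power2_eq_square \<mu>_def)
        moreover have "t * x0 - g x0 \<le> t * z - g z - \<mu> * (t * z)"
          using bounds(3)[of x0] z by (simp add: \<mu>_def)
        moreover have "t * x \<le> t * x0" using 2 t by simp
        ultimately have "t * x \<le> g x0 + (t * z - g z - \<mu> * \<bar>(x - z) / \<sigma>\<bar>)" by linarith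
        then have "exp (t * x) \<le> exp (g x0) * ?e" unfolding e by (simp add: mult_exp_exp)
        then have "exp (t * x) * p x \<le> exp (g x0) * ?e * P"
          using P[of x] pn[of x] by (intro mult_mono) (auto simp: E_def)
        then show ?thesis by (simp add: mult_ac)
      next
        case 3
        have "exp (t * x) * p x \<le> exp (t * x) * (c * exp 1 * exp (- g x))"
          using pbd(2)[OF 3] by (intro mult_left_mono) auto
        also have "\<dots> = c * exp 1 * exp (t * x - g x)" by (simp add: exp_diff exp_minus field_simps)
        also have "exp (t * x - g x) \<le> exp (t * z - g z + \<mu> - \<mu> * \<bar>(x - z) / \<sigma>\<bar>)"
          using large[OF 3] by simp
        also have "\<dots> = exp \<mu> * ?e" unfolding e by (simp add: mult_exp_exp algebra_simps)
        finally show ?thesis using c by (simp add: mult_ac)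
      qed
      moreover have "0 \<le> c * exp 1 * exp \<mu> * ?e" "0 \<le> P * exp (g x0) * ?e" using c Pn by (auto simp: E_def)
      ultimately have "exp (t * x) * p x \<le> c * exp 1 * exp \<mu> * ?e + P * exp (g x0) * ?e" by linarith
      also have "\<dots> = C * E * exp (- \<mu> * \<bar>(x - z) / \<sigma>\<bar>)" by (simp add: C_def algebra_simps)
      finally show ?thesis .
    qed
    have L: "c * exp (-1) * E * exp (- (B / 2) * ((x - z) / \<sigma>)\<^sup>2) \<le> exp (t * x) * p x"
      if "\<bar>(x - z) / \<sigma>\<bar> \<le> t * \<sigma> / 2" for x
    proof -
      \<comment> \<open>The radius t \<sigma> / 2, in units of \<sigma>, is z/2 in absolute terms,
        which stays inside the range of the quadratic lower bound.\<close>
      have "\<bar>x - z\<bar> \<le> l / 2 * \<sigma>" using that \<sigma> by (simp add: divide_le_eq l_def)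
      also have "\<dots> = z / 2" using l\<sigma> by simp
      finally have "z / 2 \<le> x \<and> x \<le> 2 * z" using z1 by linarith
      then have x: "x \<in> {z/2..2*z}" by simp
      then have xx: "x \<ge> x0" using z by auto
      have "c * exp (-1) * E * exp (- (B / 2) * ((x - z) / \<sigma>)\<^sup>2) = c * exp (-1) * exp (t * z - g z - B / 2 * ((x - z) / \<sigma>)\<^sup>2)"
        by (simp add: E_def mult_exp_exp mult.assoc del: exp_le_cancel_iff)
      also have "\<dots> \<le> c * exp (-1) * exp (t * x - g x)"
      proof -
        have "B / 2 * (t / z) * (x - z)\<^sup>2 = B / 2 * ((x - z) / \<sigma>)\<^sup>2" by (simp only: mult.assoc ysq)
        then show ?thesis using bounds(2)[OF x] c by (intro mult_left_mono) auto
      qed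
      also have "\<dots> = exp (t * x) * (c * exp (-1) * exp (- g x))" by (simp add: exp_diff exp_minus field_simps)
      also have "\<dots> \<le> exp (t * x) * p x" using pbd(1)[OF xx] by (intro mult_left_mono) auto
      finally show ?thesis .
    qed
    show "laplace_envelope p C \<mu> (c * exp (-1)) (B / 2) t"
      unfolding laplace_envelope_def using \<sigma> lt U L by (intro exI[of _ z] exI[of _ \<sigma>] exI[of _ E]) (auto simp: l_def E_def)
  qed
qed

section \<open>Moment generating function and tilted law\<close>

lemma integrable_exp_neg_abs:
  assumes "\<mu> > (0::real)"
  shows "integrable lborel (\<lambda>x::real. exp (- \<mu> * \<bar>x\<bar>))"
proof -
  have 1: "integrable lborel (\<lambda>x::real. indicator {0<..} x * exp (- \<mu> * x))"
    using integrable_I0i_exp_mscale[OF assms] by (simp add: set_integrable_def mult.commute)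
  have 2: "integrable lborel (\<lambda>x::real. indicator {0<..} (- x) * exp (- \<mu> * (- x)))"
    using lborel_integrable_real_affine[OF 1, of "-1" 0] by simp
  have "integrable lborel (\<lambda>x::real. indicator {0<..} x * exp (- \<mu> * x) + indicator {0<..} (- x) * exp (- \<mu> * (- x)))"
    by (rule Bochner_Integration.integrable_add[OF 1 2])
  then show ?thesis
  proof (rule integrable_cong_AE_imp)
    show "AE x in lborel. indicator {0<..} x * exp (- \<mu> * x) + indicator {0<..} (- x) * exp (- \<mu> * (- x)) = exp (- \<mu> * \<bar>x\<bar>)"
      using AE_lborel_singleton[of "0::real"] by eventually_elim (auto simp: indicator_def)
  qed simp
qed

text \<open>This form of the mean value bound dominates the difference quotients when the moment
  generating function is differentiated.\<close>

lemma exp_diff_abs_le: "\<bar>exp a - exp b\<bar> \<le> \<bar>a - b\<bar> * exp (max a (b::real))"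
proof -
  have *: "exp a - exp b \<le> (a - b) * exp a" "exp b \<le> exp a" if "a \<ge> b" for a b :: real
  proof -
    have "exp a - exp b = exp a * (1 - exp (b - a))" by (simp add: right_diff_distrib mult_exp_exp)
    also have "\<dots> \<le> exp a * (a - b)"
    proof (rule mult_left_mono)
      show "1 - exp (b - a) \<le> a - b" using exp_ge_add_one_self[of "b - a"] by linarith
    qed simp
    finally show "exp a - exp b \<le> (a - b) * exp a" by (simp add: mult.commute)
  qed (use that in simp)
  show ?thesis using *[of a b] *[of b a] by (cases "a \<ge> b") (auto simp: max_def)
qed

lemma power_le_exp_abs:
  assumes "j \<le> 2"
  shows "\<bar>x\<bar> ^ j \<le> 2 * exp \<bar>x::real\<bar>"
proof -
  have e: "1 + \<bar>x\<bar> + \<bar>x\<bar>\<^sup>2 / 2 \<le> exp \<bar>x\<bar>" by (rule exp_lower_Taylor_quadratic) simp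
  have "j = 0 \<or> j = 1 \<or> j = 2" using assms by linarith
  then have "\<bar>x\<bar> ^ j = 1 \<or> \<bar>x\<bar> ^ j = \<bar>x\<bar> \<or> \<bar>x\<bar> ^ j = \<bar>x\<bar>\<^sup>2" by auto
  then show ?thesis using e abs_ge_zero[of x] zero_le_power2[of "\<bar>x\<bar>"] by linarith
qed

text \<open>Decay faster than every exponential makes each real tilt integrable, so the moment
  generating function is finite on the whole line and every t has a tilted law with two
  moments.\<close>

locale superexponential_density =
  fixes p :: "real \<Rightarrow> real"
  assumes p_measurable[measurable]: "p \<in> borel_measurable borel"
    and p_nonneg: "\<And>x. p x \<ge> 0" and p_neg: "\<And>x. x < 0 \<Longrightarrow> p x = 0"
    and p_integral: "(\<integral>x. p x \<partial>lborel) = 1"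
    and p_decay: "\<And>R. \<exists>C. \<forall>x. p x \<le> C * exp (- R * \<bar>x\<bar>)"
begin

lemma integrable_moment:
  assumes "j \<le> 2"
  shows "integrable lborel (\<lambda>x. x ^ j * (exp (t * x) * p x))"
proof -
  \<comment> \<open>The rate |t| + 2 is spent in three parts: |t| against exp (t x), 1 against the
    power of x, and 1 for integrability.\<close>
  obtain C where C: "\<And>x. p x \<le> C * exp (- (\<bar>t\<bar> + 2) * \<bar>x\<bar>)" using p_decay by blast
  have "C \<ge> 0" using order_trans[OF p_nonneg C, of 0] by simp
  have "integrable lborel (\<lambda>x. 2 * C * exp (- 1 * \<bar>x\<bar>))"
    by (intro Bochner_Integration.integrable_mult_right integrable_exp_neg_abs) simp
  then show ?thesis
  proof (rule Bochner_Integration.integrable_bound)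
    show "AE x in lborel. norm (x ^ j * (exp (t * x) * p x)) \<le> norm (2 * C * exp (- 1 * \<bar>x\<bar>))"
    proof (rule AE_I2)
      fix x :: real
      have "t * x \<le> \<bar>t\<bar> * \<bar>x\<bar>" by (simp add: abs_mult[symmetric])
      then have "\<bar>x\<bar> ^ j * (exp (t * x) * p x) \<le> (2 * exp \<bar>x\<bar>) * (exp (\<bar>t\<bar> * \<bar>x\<bar>) * (C * exp (- (\<bar>t\<bar> + 2) * \<bar>x\<bar>)))"
        using power_le_exp_abs[OF assms, of x] C[of x] p_nonneg[of x] by (intro mult_mono) auto
      also have "\<dots> = 2 * C * (exp \<bar>x\<bar> * exp (\<bar>t\<bar> * \<bar>x\<bar>) * exp (- (\<bar>t\<bar> + 2) * \<bar>x\<bar>))" by simp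
      also have "exp \<bar>x\<bar> * exp (\<bar>t\<bar> * \<bar>x\<bar>) * exp (- (\<bar>t\<bar> + 2) * \<bar>x\<bar>) = exp (- 1 * \<bar>x\<bar>)"
        by (simp only: mult_exp_exp) (simp add: algebra_simps)
      finally show "norm (x ^ j * (exp (t * x) * p x)) \<le> norm (2 * C * exp (- 1 * \<bar>x\<bar>))"
        using p_nonneg[of x] \<open>C \<ge> 0\<close> by (simp add: abs_mult power_abs)
    qed
  qed simp
qed

lemma integrable_exp_p: "integrable lborel (\<lambda>x. exp (t * x) * p x)"
  using integrable_moment[of 0 t] by simp

lemma integrable_x_exp_p: "integrable lborel (\<lambda>x. x * (exp (t * x) * p x))"
  using integrable_moment[of 1 t] by simp

lemma mgf_pos: "mgf p t > 0"
proof -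
  have "mgf p t \<ge> 0" unfolding mgf_def using p_nonneg by (intro integral_nonneg_AE) auto
  moreover have "mgf p t \<noteq> 0"
  proof
    assume "mgf p t = 0"
    then have "AE x in lborel. exp (t * x) * p x = 0"
      unfolding mgf_def using integrable_exp_p p_nonneg by (subst (asm) integral_nonneg_eq_0_iff_AE) auto
    then have "AE x in lborel. p x = 0" by eventually_elim simp
    then have "(\<integral>x. p x \<partial>lborel) = 0" using integral_eq_zero_AE by blast
    then show False using p_integral by simp
  qed
  ultimately show ?thesis by simp
qed

lemma mgf_has_derivative:
  "((\<lambda>s. mgf p s) has_real_derivative (\<integral>x. x * (exp (t * x) * p x) \<partial>lborel)) (at t)"
  unfolding has_field_derivative_iff tendsto_at_iff_sequentially
proof (intro allI impI)
  fix s :: "nat \<Rightarrow> real" assume s: "\<forall>i. s i \<in> UNIV - {t}" "s \<longlonglongrightarrow> t"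
  from s(2) have "bounded (range s)" by (rule convergent_imp_bounded)
  then obtain K where K: "\<And>i. \<bar>s i\<bar> \<le> K" by (auto simp: bounded_iff)
  \<comment> \<open>As p lives on x >= 0, the largest exponent b dominates exp (s_i x) and exp (t x)
    at once, and x exp (b x) p(x) is an integrable majorant for all difference quotients along the
    sequence.\<close>
  define b where "b = max K t"
  have eq: "(mgf p (s i) - mgf p t) / (s i - t) = (\<integral>x. (exp (s i * x) - exp (t * x)) / (s i - t) * p x \<partial>lborel)" for i
  proof -
    have "(\<integral>x. (exp (s i * x) - exp (t * x)) / (s i - t) * p x \<partial>lborel)
        = (\<integral>x. (exp (s i * x) * p x - exp (t * x) * p x) / (s i - t) \<partial>lborel)"
      by (rule Bochner_Integration.integral_cong) (auto simp: left_diff_distrib)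
    also have "\<dots> = (\<integral>x. exp (s i * x) * p x - exp (t * x) * p x \<partial>lborel) / (s i - t)"
      by (rule integral_divide_zero)
    also have "\<dots> = (mgf p (s i) - mgf p t) / (s i - t)"
      unfolding mgf_def by (subst Bochner_Integration.integral_diff[OF integrable_exp_p integrable_exp_p]) simp
    finally show ?thesis by (rule sym)
  qed
  have "(\<lambda>i. (\<integral>x. (exp (s i * x) - exp (t * x)) / (s i - t) * p x \<partial>lborel)) \<longlonglongrightarrow> (\<integral>x. x * (exp (t * x) * p x) \<partial>lborel)"
  proof (rule integral_dominated_convergence[where w = "\<lambda>x. x * (exp (b * x) * p x)"])
    show "AE x in lborel. (\<lambda>i. (exp (s i * x) - exp (t * x)) / (s i - t) * p x) \<longlonglongrightarrow> x * (exp (t * x) * p x)"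
    proof (rule AE_I2)
      fix x :: real
      have "((\<lambda>s. exp (s * x)) has_real_derivative x * exp (t * x)) (at t)"
        by (auto intro!: derivative_eq_intros)
      then have "(\<lambda>i. (exp (s i * x) - exp (t * x)) / (s i - t)) \<longlonglongrightarrow> x * exp (t * x)"
        unfolding has_field_derivative_iff tendsto_at_iff_sequentially using s by (auto simp: comp_def)
      from tendsto_mult_right[OF this, of "p x"]
      show "(\<lambda>i. (exp (s i * x) - exp (t * x)) / (s i - t) * p x) \<longlonglongrightarrow> x * (exp (t * x) * p x)"
        by (simp add: mult.assoc)
    qed
    show "AE x in lborel. norm ((exp (s i * x) - exp (t * x)) / (s i - t) * p x) \<le> x * (exp (b * x) * p x)" for i
    proof (rule AE_I2)
      fix x :: real
      show "norm ((exp (s i * x) - exp (t * x)) / (s i - t) * p x) \<le> x * (exp (b * x) * p x)"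
      proof (cases "x < 0")
        case False
        have "max (s i * x) (t * x) \<le> b * x"
          using False K[of i] by (auto simp: b_def abs_le_iff max_def intro!: mult_right_mono)
        then have "\<bar>exp (s i * x) - exp (t * x)\<bar> \<le> \<bar>s i * x - t * x\<bar> * exp (b * x)"
          by (intro order_trans[OF exp_diff_abs_le] mult_left_mono) auto
        also have "\<bar>s i * x - t * x\<bar> = \<bar>s i - t\<bar> * x" using False by (simp add: left_diff_distrib[symmetric] abs_mult)
        finally have "\<bar>(exp (s i * x) - exp (t * x)) / (s i - t)\<bar> \<le> x * exp (b * x)"
          using s(1)[rule_format, of i] by (simp add: divide_le_eq mult_ac)
        from mult_right_mono[OF this p_nonneg[of x]] show ?thesis
          using p_nonneg[of x] by (simp add: abs_mult mult.assoc)
      qed (simp add: p_neg)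
    qed
  qed (auto intro: integrable_x_exp_p)
  then show "((\<lambda>y. (mgf p y - mgf p t) / (y - t)) \<circ> s) \<longlonglongrightarrow> (\<integral>x. x * (exp (t * x) * p x) \<partial>lborel)"
    by (simp add: comp_def eq)
qed

lemma mfun_eq: "mfun p t = (\<integral>x. x * (exp (t * x) * p x) \<partial>lborel) / mgf p t"
proof -
  have "((\<lambda>s. ln (mgf p s)) has_real_derivative 1 / mgf p t * (\<integral>x. x * (exp (t * x) * p x) \<partial>lborel)) (at t)"
    using mgf_has_derivative[of t] mgf_pos[of t] by (auto intro!: derivative_eq_intros)
  from DERIV_imp_deriv[OF this] show ?thesis by (simp add: mfun_def)
qed

lemma mfun_mono:
  assumes "t \<le> T"
  shows "mfun p t \<le> mfun p T"
proof -
  let ?a = "mfun p T"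
  have cent: "(\<integral>x. (x - ?a) * (exp (s * x) * p x) \<partial>lborel) = (mfun p s - ?a) * mgf p s" for s
    using integrable_x_exp_p[of s] integrable_exp_p[of s] mgf_pos[of s]
    by (simp add: left_diff_distrib Bochner_Integration.integral_diff mfun_eq mgf_def)
  have int: "integrable lborel (\<lambda>x. (x - ?a) * (exp (s * x) * p x))" for s
    using integrable_x_exp_p[of s] integrable_exp_p[of s] by (simp add: left_diff_distrib)
  have "(\<integral>x. (x - ?a) * (exp (t * x) * p x) \<partial>lborel)
      \<le> (\<integral>x. exp ((t - T) * ?a) * ((x - ?a) * (exp (T * x) * p x)) \<partial>lborel)"
  proof (intro integral_mono Bochner_Integration.integrable_mult_right int)
    fix x
    have e: "exp (t * x) = exp ((t - T) * x) * exp (T * x)" by (simp only: mult_exp_exp) (simp add: algebra_simps)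
    have "(x - ?a) * exp ((t - T) * x) \<le> (x - ?a) * exp ((t - T) * ?a)"
    proof (cases "x \<ge> ?a")
      case True
      then have "(t - T) * x \<le> (t - T) * ?a" using assms by (intro mult_left_mono_neg) auto
      then show ?thesis using True by (intro mult_left_mono) auto
    next
      case False
      then have "(t - T) * ?a \<le> (t - T) * x" using assms by (intro mult_left_mono_neg) auto
      then show ?thesis using False by (intro mult_left_mono_neg) auto
    qed
    then have "(x - ?a) * exp ((t - T) * x) * (exp (T * x) * p x) \<le> (x - ?a) * exp ((t - T) * ?a) * (exp (T * x) * p x)"
      using p_nonneg[of x] by (intro mult_right_mono) auto
    then show "(x - ?a) * (exp (t * x) * p x) \<le> exp ((t - T) * ?a) * ((x - ?a) * (exp (T * x) * p x))"
      unfolding e by (simp add: mult_ac)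
  qed
  also have "\<dots> = 0" using cent[of T] by simp
  finally have "(mfun p t - ?a) * mgf p t \<le> 0" unfolding cent .
  then show ?thesis using mgf_pos[of t] by (simp add: mult_le_0_iff)
qed

text \<open>The product lemmas tilt the law of one summand, while \<open>tilted\<close> is a density
  against Lebesgue measure; this identifies the two descriptions.\<close>

lemma tilted_eq_density:
  "tilted p t = density (density lborel (\<lambda>x. ennreal (p x))) (\<lambda>x. ennreal (exp (t * x) / mgf p t))"
  unfolding tilted_def using p_nonneg mgf_pos[of t]
  by (subst density_density_eq) (auto intro!: density_cong simp: ennreal_mult'[symmetric] mult_ac)

lemma
  assumes [measurable]: "f \<in> borel_measurable borel"
  shows integrable_tilted: "integrable (tilted p t) f \<longleftrightarrow> integrable lborel (\<lambda>x. f x * (exp (t * x) * p x))"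
    and integral_tilted: "(\<integral>x. f x \<partial>tilted p t) = (\<integral>x. f x * (exp (t * x) * p x) \<partial>lborel) / mgf p t"
proof -
  have nn: "AE x in lborel. 0 \<le> exp (t * x) * p x / mgf p t" using p_nonneg mgf_pos[of t] by (simp add: less_imp_le)
  have eq: "(exp (t * x) * p x / mgf p t) *\<^sub>R f x = 1 / mgf p t * (f x * (exp (t * x) * p x))" for x by simp
  have "integrable (tilted p t) f \<longleftrightarrow> integrable lborel (\<lambda>x. 1 / mgf p t * (f x * (exp (t * x) * p x)))"
    unfolding tilted_def by (subst integrable_density) (simp_all only: eq nn, measurable)
  then show "integrable (tilted p t) f \<longleftrightarrow> integrable lborel (\<lambda>x. f x * (exp (t * x) * p x))"
    using mgf_pos[of t] by (subst (asm) integrable_mult_left_iff) simp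
  have "(\<integral>x. f x \<partial>tilted p t) = (\<integral>x. 1 / mgf p t * (f x * (exp (t * x) * p x)) \<partial>lborel)"
    unfolding tilted_def by (subst integral_density) (simp_all only: eq nn, measurable)
  then show "(\<integral>x. f x \<partial>tilted p t) = (\<integral>x. f x * (exp (t * x) * p x) \<partial>lborel) / mgf p t"
    by simp
qed

lemma prob_space_p: "prob_space (density lborel (\<lambda>x. ennreal (p x)))"
proof
  have "(\<integral>\<^sup>+x. ennreal (p x) \<partial>lborel) = ennreal (\<integral>x. p x \<partial>lborel)"
    using integrable_exp_p[of 0] p_nonneg by (intro nn_integral_eq_integral) auto
  then show "emeasure (density lborel (\<lambda>x. ennreal (p x))) (space (density lborel (\<lambda>x. ennreal (p x)))) = 1"
    by (simp add: emeasure_density p_integral)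
qed

lemma prob_space_tilted: "prob_space (tilted p t)"
proof
  have "(\<integral>\<^sup>+x. ennreal (exp (t * x) * p x / mgf p t) \<partial>lborel) = ennreal (\<integral>x. exp (t * x) * p x / mgf p t \<partial>lborel)"
    using integrable_exp_p[of t] p_nonneg mgf_pos[of t] by (intro nn_integral_eq_integral) (auto simp: less_imp_le)
  also have "(\<integral>x. exp (t * x) * p x / mgf p t \<partial>lborel) = 1"
    using mgf_pos[of t] by (simp add: mgf_def[symmetric])
  finally show "emeasure (tilted p t) (space (tilted p t)) = 1"
    by (simp add: tilted_def emeasure_density)
qed

end

text \<open>This is all that the probabilistic part asks of the analysis: a single scale \<sigma>
  for the density from above, the density from below and the variance. The centre is the mean
  \<open>mfun p t\<close> rather than the saddle point. \<sigma> may depend on t, whereas C, c and V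
  are to serve all large t.\<close>

definition tilted_scale :: "(real \<Rightarrow> real) \<Rightarrow> real \<Rightarrow> real \<Rightarrow> real \<Rightarrow> real \<Rightarrow> bool" where
  "tilted_scale p C c V t \<longleftrightarrow> (\<exists>\<sigma>>0. t * \<sigma> \<ge> 1 \<and> (\<forall>x. exp (t * x) * p x \<le> mgf p t * (C / \<sigma>)) \<and>
         (\<forall>x. \<bar>x - mfun p t\<bar> \<le> 2 * \<sigma> \<longrightarrow> mgf p t * (c / \<sigma>) \<le> exp (t * x) * p x) \<and>
         (\<integral>x. (x - mfun p t)\<^sup>2 \<partial>tilted p t) \<le> V * \<sigma>\<^sup>2)"

context superexponential_density
begin

text \<open>Integrating the envelopes shows that the moment generating function is of order E
  \<sigma> and that the second moment of the tilted law about z is at most V \<sigma>^2. This moment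
  is the variance plus the squared distance of the mean from z, so both are bounded at once. The
  mean thus lies within sqrt V \<sigma> of z, and a window of radius 2 \<sigma> about it stays
  within A \<sigma> of z, inside the reach of the lower envelope.\<close>

lemma tilted_scale_bounds:
  assumes C: "C > 0" and c': "c' > 0" and \<mu>: "\<mu> > 0"
  obtains C2 c2 V T where "C2 > 0" "c2 > 0" "V \<ge> 0" "T \<ge> 1"
    "\<forall>t\<ge>T. laplace_envelope p C \<mu> c' B t \<longrightarrow> tilted_scale p C2 c2 V t"
proof -
  define I where "I = (\<integral>y. exp (- \<mu> * \<bar>y::real\<bar>) \<partial>lborel)"
  define J where "J = (\<integral>y. y\<^sup>2 * exp (- \<mu> * \<bar>y::real\<bar>) \<partial>lborel)"
  \<comment> \<open>The lower envelope is at least c' E exp (-|B|) on [z - \<sigma>, z + \<sigma>],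
    an interval of length 2 \<sigma>.\<close>
  define k where "k = 2 * c' * exp (- \<bar>B\<bar>)"
  define V where "V = C / k * J"
  define A where "A = 2 + sqrt V"
  \<comment> \<open>As (t \<sigma>)^2 >= t, this threshold forces t \<sigma> >= 2 A and t \<sigma>
    >= 2, which puts the radii A and 1 inside the range t \<sigma> / 2 of the lower
    envelope.\<close>
  define T where "T = max 4 (4 * A\<^sup>2)"
  \<comment> \<open>I + 1 in place of I makes the denominator visibly positive, and |B| spares a
    case distinction on the sign of B.\<close>
  define c2 where "c2 = c' * exp (- \<bar>B\<bar> * A\<^sup>2) / (C * (I + 1))"
  have k: "k > 0" using c' by (simp add: k_def)
  have I: "I \<ge> 0" unfolding I_def by (intro integral_nonneg_AE) auto
  have J: "J \<ge> 0" unfolding J_def by (intro integral_nonneg_AE) auto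
  have V: "V \<ge> 0" using C k J by (simp add: V_def)
  have iI: "integrable lborel (\<lambda>y::real. exp (- \<mu> * \<bar>y\<bar>))" by (rule integrable_exp_neg_abs[OF \<mu>])
  have iJ: "integrable lborel (\<lambda>y::real. y\<^sup>2 * exp (- \<mu> * \<bar>y\<bar>))"
  proof (rule Bochner_Integration.integrable_bound)
    show "integrable lborel (\<lambda>y::real. 8 / \<mu>\<^sup>2 * exp (- (\<mu> / 2) * \<bar>y\<bar>))"
      using \<mu> by (intro Bochner_Integration.integrable_mult_right integrable_exp_neg_abs) simp
    show "AE y::real in lborel. norm (y\<^sup>2 * exp (- \<mu> * \<bar>y\<bar>)) \<le> norm (8 / \<mu>\<^sup>2 * exp (- (\<mu> / 2) * \<bar>y\<bar>))"
    proof (rule AE_I2)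
      fix y :: real
      \<comment> \<open>Half of the decay rate absorbs the square; the other half remains for
        integrability.\<close>
      have "(\<mu> / 2 * y)\<^sup>2 \<le> 2 * exp \<bar>\<mu> / 2 * y\<bar>" using power_le_exp_abs[of 2 "\<mu> / 2 * y"] by (simp only: power2_abs order_refl)
      then have "y\<^sup>2 \<le> 8 / \<mu>\<^sup>2 * exp (\<mu> / 2 * \<bar>y\<bar>)" using \<mu> by (simp add: power_mult_distrib power_divide field_simps abs_mult)
      then have "y\<^sup>2 * exp (- \<mu> * \<bar>y\<bar>) \<le> 8 / \<mu>\<^sup>2 * exp (\<mu> / 2 * \<bar>y\<bar>) * exp (- \<mu> * \<bar>y\<bar>)"
        by (intro mult_right_mono) auto
      also have "\<dots> = 8 / \<mu>\<^sup>2 * exp (- (\<mu> / 2) * \<bar>y\<bar>)"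
        by (simp only: mult.assoc mult_exp_exp) (simp add: algebra_simps)
      finally show "norm (y\<^sup>2 * exp (- \<mu> * \<bar>y\<bar>)) \<le> norm (8 / \<mu>\<^sup>2 * exp (- (\<mu> / 2) * \<bar>y\<bar>))" by simp
    qed
  qed simp
  show ?thesis
  proof
    show "C / k > 0" "c2 > 0" "V \<ge> 0" "T \<ge> 1"
      using C k c' I V by (auto simp: c2_def T_def)
    show "\<forall>t\<ge>T. laplace_envelope p C \<mu> c' B t \<longrightarrow> tilted_scale p (C / k) c2 V t"
    proof (intro allI impI)
      fix t :: real
      assume t: "t \<ge> T" and "laplace_envelope p C \<mu> c' B t"
      then obtain z \<sigma> E where \<sigma>: "\<sigma> > 0" and E: "E > 0" and l: "(t * \<sigma>)\<^sup>2 \<ge> t"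
        and up: "\<And>x. exp (t * x) * p x \<le> C * E * exp (- \<mu> * \<bar>(x - z) / \<sigma>\<bar>)"
        and lo: "\<And>x. \<bar>(x - z) / \<sigma>\<bar> \<le> t * \<sigma> / 2 \<Longrightarrow> c' * E * exp (- B * ((x - z) / \<sigma>)\<^sup>2) \<le> exp (t * x) * p x"
        unfolding laplace_envelope_def by blast
      have tA: "2 * A \<le> t * \<sigma>" "2 \<le> t * \<sigma>"
      proof -
        have "(2 * A)\<^sup>2 \<le> (t * \<sigma>)\<^sup>2" "2\<^sup>2 \<le> (t * \<sigma>)\<^sup>2" using t l by (auto simp: T_def power_mult_distrib)
        moreover have "t * \<sigma> \<ge> 0" using t \<sigma> by (simp add: T_def)
        ultimately show "2 * A \<le> t * \<sigma>" "2 \<le> t * \<sigma>" by (auto intro: power2_le_imp_le)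
      qed
      have scale: "(\<integral>x. F ((x - z) / \<sigma>) \<partial>lborel) = \<sigma> * (\<integral>y. F y \<partial>lborel)"
        and iscale: "integrable lborel F \<Longrightarrow> integrable lborel (\<lambda>x. F ((x - z) / \<sigma>))" for F :: "real \<Rightarrow> real"
      proof -
        show "(\<integral>x. F ((x - z) / \<sigma>) \<partial>lborel) = \<sigma> * (\<integral>y. F y \<partial>lborel)"
          using lborel_integral_real_affine[of \<sigma> "\<lambda>x. F ((x - z) / \<sigma>)" z] \<sigma> by simp
        have "(\<lambda>x. F ((x - z) / \<sigma>)) = (\<lambda>x. F (- z / \<sigma> + (1 / \<sigma>) * x))" by (simp add: diff_divide_distrib)
        then show "integrable lborel F \<Longrightarrow> integrable lborel (\<lambda>x. F ((x - z) / \<sigma>))"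
          using lborel_integrable_real_affine[of F "1 / \<sigma>" "- z / \<sigma>"] \<sigma> by simp
      qed
      let ?\<phi> = "mgf p t" and ?a = "mfun p t"
      have \<phi>: "?\<phi> > 0" by (rule mgf_pos)
      have \<phi>_up: "?\<phi> \<le> C * E * \<sigma> * (I + 1)"
      proof -
        have "?\<phi> \<le> (\<integral>x. C * E * exp (- \<mu> * \<bar>(x - z) / \<sigma>\<bar>) \<partial>lborel)"
          unfolding mgf_def using up iscale[OF iI]
          by (intro integral_mono integrable_exp_p Bochner_Integration.integrable_mult_right) auto
        also have "\<dots> = C * E * (\<sigma> * I)" unfolding I_def scale[symmetric] by simp
        also have "\<dots> \<le> C * E * (\<sigma> * (I + 1))" using C E \<sigma> I by (intro mult_left_mono) auto
        finally show ?thesis by (simp add: mult_ac)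
      qed
      have \<phi>_lo: "k * E * \<sigma> \<le> ?\<phi>"
      proof -
        have "k * E * \<sigma> = (\<integral>x. c' * E * exp (- \<bar>B\<bar>) * indicator {z - \<sigma>..z + \<sigma>} x \<partial>lborel)"
          using \<sigma> by (simp add: k_def)
        also have "\<dots> \<le> ?\<phi>" unfolding mgf_def
        proof (intro integral_mono integrable_exp_p)
          show "integrable lborel (\<lambda>x. c' * E * exp (- \<bar>B\<bar>) * indicator {z - \<sigma>..z + \<sigma>} x)"
            by (intro Bochner_Integration.integrable_mult_right integrable_real_indicator) (auto simp: emeasure_lborel_Icc_eq)
          fix x
          show "c' * E * exp (- \<bar>B\<bar>) * indicator {z - \<sigma>..z + \<sigma>} x \<le> exp (t * x) * p x"
          proof (cases "x \<in> {z - \<sigma>..z + \<sigma>}")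
            case True
            then have y: "\<bar>(x - z) / \<sigma>\<bar> \<le> 1" using \<sigma> by (simp add: divide_le_eq abs_le_iff)
            then have "((x - z) / \<sigma>)\<^sup>2 \<le> 1" by (simp add: abs_square_le_1)
            then have "\<bar>B\<bar> * ((x - z) / \<sigma>)\<^sup>2 \<le> \<bar>B\<bar> * 1" by (intro mult_left_mono) auto
            moreover have "B * ((x - z) / \<sigma>)\<^sup>2 \<le> \<bar>B\<bar> * ((x - z) / \<sigma>)\<^sup>2" by (intro mult_right_mono) auto
            ultimately have "- \<bar>B\<bar> \<le> - B * ((x - z) / \<sigma>)\<^sup>2" by linarith
            then have "c' * E * exp (- \<bar>B\<bar>) \<le> c' * E * exp (- B * ((x - z) / \<sigma>)\<^sup>2)"
              using c' E by (intro mult_left_mono) auto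
            also have "\<dots> \<le> exp (t * x) * p x" by (rule lo) (use y tA in linarith)
            finally show ?thesis using True by simp
          qed (use p_nonneg[of x] in simp)
        qed
        finally show ?thesis .
      qed
      have ratio: "C * E \<le> ?\<phi> * (C / k / \<sigma>)"
      proof -
        have "k * E * \<sigma> * (C / k / \<sigma>) \<le> ?\<phi> * (C / k / \<sigma>)" using \<phi>_lo C k \<sigma> by (intro mult_right_mono) auto
        moreover have "k * E * \<sigma> * (C / k / \<sigma>) = C * E" using k \<sigma> by simp
        ultimately show ?thesis by simp
      qed
      have 1: "exp (t * x) * p x \<le> ?\<phi> * (C / k / \<sigma>)" for x
      proof -
        have "C * E * exp (- \<mu> * \<bar>(x - z) / \<sigma>\<bar>) \<le> C * E * 1" using C E \<mu> by (intro mult_left_mono) auto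
        then show ?thesis using up[of x] ratio by linarith
      qed
      interpret G: prob_space "tilted p t" by (rule prob_space_tilted)
      have ix: "integrable (tilted p t) (\<lambda>x. x)" using integrable_tilted[of "\<lambda>x. x"] integrable_x_exp_p by simp
      have ix2: "integrable (tilted p t) (\<lambda>x. x\<^sup>2)" using integrable_tilted[of "\<lambda>x. x\<^sup>2"] integrable_moment[of 2] by simp
      have a: "(\<integral>x. x \<partial>tilted p t) = ?a" using integral_tilted[of "\<lambda>x. x"] mfun_eq by simp
      have dec: "(\<integral>x. (x - z)\<^sup>2 \<partial>tilted p t) = (\<integral>x. (x - ?a)\<^sup>2 \<partial>tilted p t) + (?a - z)\<^sup>2"
      proof -
        define d where "d = ?a - z"
        have eq: "(x - z)\<^sup>2 = (x - ?a)\<^sup>2 + 2 * d * (x - ?a) + d\<^sup>2" for x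
          by (simp add: d_def power2_eq_square algebra_simps)
        have ia: "integrable (tilted p t) (\<lambda>x. (x - ?a)\<^sup>2)" using ix ix2 by (simp add: power2_diff)
        have i1: "integrable (tilted p t) (\<lambda>x. 2 * d * (x - ?a))" using ix by simp
        have "(\<integral>x. 2 * d * (x - ?a) \<partial>tilted p t) = 0" using ix by (simp add: a G.prob_space)
        then show ?thesis
          unfolding eq d_def[symmetric] using ia i1 by (simp add: G.prob_space)
      qed
      have i2: "integrable lborel (\<lambda>x. (x - z)\<^sup>2 * (exp (t * x) * p x))"
      proof -
        have "integrable (tilted p t) (\<lambda>x. (x - z)\<^sup>2)" using ix ix2 by (simp add: power2_diff)
        then show ?thesis by (subst (asm) integrable_tilted) auto
      qed
      have "(\<integral>x. (x - z)\<^sup>2 * (exp (t * x) * p x) \<partial>lborel)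
          \<le> (\<integral>x. C * E * \<sigma>\<^sup>2 * (((x - z) / \<sigma>)\<^sup>2 * exp (- \<mu> * \<bar>(x - z) / \<sigma>\<bar>)) \<partial>lborel)"
      proof (intro integral_mono i2 Bochner_Integration.integrable_mult_right iscale[OF iJ])
        fix x
        have "(x - z)\<^sup>2 * (exp (t * x) * p x) \<le> (x - z)\<^sup>2 * (C * E * exp (- \<mu> * \<bar>(x - z) / \<sigma>\<bar>))"
          using up[of x] by (intro mult_left_mono) auto
        also have "\<dots> = C * E * \<sigma>\<^sup>2 * (((x - z) / \<sigma>)\<^sup>2 * exp (- \<mu> * \<bar>(x - z) / \<sigma>\<bar>))"
          using \<sigma> by (simp add: power_divide)
        finally show "(x - z)\<^sup>2 * (exp (t * x) * p x) \<le> C * E * \<sigma>\<^sup>2 * (((x - z) / \<sigma>)\<^sup>2 * exp (- \<mu> * \<bar>(x - z) / \<sigma>\<bar>))" .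
      qed
      also have "\<dots> = C * E * \<sigma>\<^sup>2 * (\<sigma> * J)"
        unfolding J_def scale[of "\<lambda>y. y\<^sup>2 * exp (- \<mu> * \<bar>y\<bar>)", symmetric] by simp
      also have "\<dots> \<le> ?\<phi> * (C / k / \<sigma>) * (\<sigma>\<^sup>2 * (\<sigma> * J))"
        using mult_right_mono[OF ratio, of "\<sigma>\<^sup>2 * (\<sigma> * J)"] \<sigma> J by (simp add: mult.assoc)
      also have "\<dots> = ?\<phi> * (V * \<sigma>\<^sup>2)" using \<sigma> by (simp add: V_def)
      finally have "(\<integral>x. (x - z)\<^sup>2 \<partial>tilted p t) \<le> V * \<sigma>\<^sup>2"
        using integral_tilted[of "\<lambda>x. (x - z)\<^sup>2" t] \<phi> by (simp add: divide_le_eq mult.commute)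
      then have sum: "(\<integral>x. (x - ?a)\<^sup>2 \<partial>tilted p t) + (?a - z)\<^sup>2 \<le> V * \<sigma>\<^sup>2" using dec by simp
      moreover have "0 \<le> (\<integral>x. (x - ?a)\<^sup>2 \<partial>tilted p t)" by simp
      ultimately have az: "(?a - z)\<^sup>2 \<le> (sqrt V * \<sigma>)\<^sup>2" and 2: "(\<integral>x. (x - ?a)\<^sup>2 \<partial>tilted p t) \<le> V * \<sigma>\<^sup>2"
        using V by (auto simp: power_mult_distrib intro: order_trans[rotated])
      have az: "\<bar>?a - z\<bar> \<le> sqrt V * \<sigma>" using az V \<sigma> abs_le_square_iff[of "?a - z" "sqrt V * \<sigma>"] by simp
      have 3: "?\<phi> * (c2 / \<sigma>) \<le> exp (t * x) * p x" if x: "\<bar>x - ?a\<bar> \<le> 2 * \<sigma>" for x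
      proof -
        have "\<bar>x - z\<bar> \<le> A * \<sigma>" using x az by (simp add: A_def algebra_simps)
        then have y: "\<bar>(x - z) / \<sigma>\<bar> \<le> A" using \<sigma> by (simp add: divide_le_eq)
        have "?\<phi> * (c2 / \<sigma>) \<le> C * E * \<sigma> * (I + 1) * (c2 / \<sigma>)"
          using \<phi>_up \<sigma> C c' I by (intro mult_right_mono) (auto simp: c2_def)
        also have "\<dots> = c' * E * exp (- \<bar>B\<bar> * A\<^sup>2)" using C I \<sigma> by (simp add: c2_def)
        also have "\<dots> \<le> c' * E * exp (- B * ((x - z) / \<sigma>)\<^sup>2)"
        proof -
          have "((x - z) / \<sigma>)\<^sup>2 \<le> A\<^sup>2" using power_mono[OF y abs_ge_zero, of 2] by (simp only: power2_abs)
          then have "\<bar>B\<bar> * ((x - z) / \<sigma>)\<^sup>2 \<le> \<bar>B\<bar> * A\<^sup>2" by (intro mult_left_mono) auto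
          moreover have "B * ((x - z) / \<sigma>)\<^sup>2 \<le> \<bar>B\<bar> * ((x - z) / \<sigma>)\<^sup>2" by (intro mult_right_mono) auto
          ultimately have "- \<bar>B\<bar> * A\<^sup>2 \<le> - B * ((x - z) / \<sigma>)\<^sup>2" by linarith
          then show ?thesis using c' E by (intro mult_left_mono) auto
        qed
        also have "\<dots> \<le> exp (t * x) * p x" by (rule lo) (use y tA in linarith)
        finally show ?thesis .
      qed
      show "tilted_scale p (C / k) c2 V t"
        unfolding tilted_scale_def
        using 1 2 3 \<sigma> tA(2) by (intro exI[of _ \<sigma>]) auto
    qed
  qed
qed

section \<open>Exponential tail bounds and masses of intervals\<close>

lemma emeasure_tail_le:
  assumes t: "t > 0" and K: "K \<ge> 0" and up: "\<And>x. exp (t * x) * p x \<le> K"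
  shows "emeasure (density lborel (\<lambda>x. ennreal (p x))) {s..} \<le> ennreal (K / t * exp (- t * s))"
proof -
  have "emeasure (density lborel (\<lambda>x. ennreal (p x))) {s..} = (\<integral>\<^sup>+x. ennreal (p x) * indicator {s..} x \<partial>lborel)"
    by (rule emeasure_density) auto
  also have "\<dots> \<le> (\<integral>\<^sup>+x. ennreal (K * exp (- t * x)) * indicator {s..} x \<partial>lborel)"
  proof (intro nn_integral_mono mult_right_mono ennreal_leI)
    fix x
    have "p x = exp (t * x) * p x * exp (- t * x)" by (simp add: exp_minus)
    also have "\<dots> \<le> K * exp (- t * x)" using up by (intro mult_right_mono) auto
    finally show "p x \<le> K * exp (- t * x)" .
  qed auto
  also have "\<dots> = ennreal (0 - (- K / t * exp (- t * s)))"
  proof (rule nn_integral_FTC_atLeast)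
    show "((\<lambda>x. - K / t * exp (- t * x)) has_real_derivative K * exp (- t * x)) (at x)" for x
      using t by (auto intro!: derivative_eq_intros)
    have "((\<lambda>x. exp (- t * x)) \<longlongrightarrow> 0) at_top"
      using t by real_asymp
    then show "((\<lambda>x. - K / t * exp (- t * x)) \<longlongrightarrow> 0) at_top"
      by (rule tendsto_mult_right_zero)
  qed (use K in auto)
  finally show ?thesis by simp
qed

text \<open>The integral of e^(-tx) over [s, s + \<sigma>] is the full tail integral times 1 - e^(-t
  \<sigma>), and t \<sigma> >= 1 makes this factor at least 1/2. A bound on p over one window of
  length \<sigma> therefore loses only a factor 2.\<close>

lemma emeasure_tail_ge:
  assumes t: "t > 0" and K: "K \<ge> 0" and \<sigma>: "\<sigma> > 0" "t * \<sigma> \<ge> 1"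
    and lo: "\<And>x. x \<in> {s..s+\<sigma>} \<Longrightarrow> K \<le> exp (t * x) * p x"
  shows "ennreal (K / (2 * t) * exp (- t * s)) \<le> emeasure (density lborel (\<lambda>x. ennreal (p x))) {s..}"
proof -
  have "K / (2 * t) * exp (- t * s) \<le> - K / t * exp (- t * (s + \<sigma>)) - (- K / t * exp (- t * s))"
  proof -
    have "2 \<le> exp (t * \<sigma>)" using exp_ge_add_one_self[of "t * \<sigma>"] \<sigma> by linarith
    then have "exp (- (t * \<sigma>)) \<le> 1 / 2" by (simp add: exp_minus field_simps)
    then have "K / t * exp (- t * s) * exp (- (t * \<sigma>)) \<le> K / t * exp (- t * s) * (1 / 2)"
      using K t by (intro mult_left_mono) auto
    moreover have "exp (- t * (s + \<sigma>)) = exp (- t * s) * exp (- (t * \<sigma>))" by (simp add: mult_exp_exp algebra_simps)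
    ultimately show ?thesis by simp
  qed
  then have "ennreal (K / (2 * t) * exp (- t * s)) \<le> ennreal (- K / t * exp (- t * (s + \<sigma>)) - (- K / t * exp (- t * s)))"
    by (rule ennreal_leI)
  also have "\<dots> = (\<integral>\<^sup>+x. ennreal (K * exp (- t * x)) * indicator {s..s+\<sigma>} x \<partial>lborel)"
  proof (rule nn_integral_FTC_Icc[symmetric])
    show "((\<lambda>x. - K / t * exp (- t * x)) has_real_derivative K * exp (- t * x)) (at x)" for x
      using t by (auto intro!: derivative_eq_intros)
  qed (use K \<sigma> in auto)
  also have "\<dots> \<le> (\<integral>\<^sup>+x. ennreal (p x) * indicator {s..} x \<partial>lborel)"
  proof (intro nn_integral_mono)
    fix x
    show "ennreal (K * exp (- t * x)) * indicator {s..s+\<sigma>} x \<le> ennreal (p x) * indicator {s..} x"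
    proof (cases "x \<in> {s..s+\<sigma>}")
      case True
      have "K * exp (- t * x) \<le> exp (t * x) * p x * exp (- t * x)" using lo[OF True] by (intro mult_right_mono) auto
      also have "\<dots> = p x" by (simp add: exp_minus)
      finally show ?thesis using True by (auto intro!: ennreal_leI)
    qed simp
  qed
  also have "\<dots> = emeasure (density lborel (\<lambda>x. ennreal (p x))) {s..}"
    by (rule emeasure_density[symmetric]) auto
  finally show ?thesis .
qed

lemma measure_tilted_Icc_ge:
  assumes lo: "\<And>x. x \<in> {u..v} \<Longrightarrow> mgf p t * K \<le> exp (t * x) * p x" and uv: "u \<le> v" and K: "K \<ge> 0"
  shows "K * (v - u) \<le> measure (tilted p t) {u..v}"
proof -
  interpret G: prob_space "tilted p t" by (rule prob_space_tilted)
  have "ennreal (K * (v - u)) = (\<integral>\<^sup>+x. ennreal K * indicator {u..v} x \<partial>lborel)"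
    using uv K by (simp add: nn_integral_cmult_indicator ennreal_mult)
  also have "\<dots> \<le> (\<integral>\<^sup>+x. ennreal (exp (t * x) * p x / mgf p t) * indicator {u..v} x \<partial>lborel)"
    using lo mgf_pos[of t] by (intro nn_integral_mono) (auto simp: indicator_def pos_le_divide_eq mult.commute intro!: ennreal_leI)
  also have "\<dots> = emeasure (tilted p t) {u..v}"
    unfolding tilted_def by (rule emeasure_density[symmetric]) auto
  finally show ?thesis by (simp add: G.emeasure_eq_measure)
qed

end

section \<open>Convergence of the conditioned law\<close>

text \<open>The estimate contains neither t nor \<sigma>: the tail constants enter only through
  their quotient, where both cancel. For this reason t may vary with N at any rate.\<close>

lemma (in superexponential_density) conditioned_coordinate_close_to_tilted:
  assumes C: "C > 0" and c: "c > 0" and V: "V \<ge> 0" and t: "t > 0" and \<sigma>: "\<sigma> > 0" "t * \<sigma> \<ge> 1"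
    and up: "\<And>x. exp (t * x) * p x \<le> mgf p t * (C / \<sigma>)"
    and lo: "\<And>x. \<bar>x - mfun p t\<bar> \<le> 2 * \<sigma> \<Longrightarrow> mgf p t * (c / \<sigma>) \<le> exp (t * x) * p x"
    and var: "(\<integral>x. (x - mfun p t)\<^sup>2 \<partial>tilted p t) \<le> V * \<sigma>\<^sup>2"
    and B: "B \<in> sets borel" and m: "m \<le> N" "8 * V * real N \<le> (real m)\<^sup>2" and N: "N > 0" and \<epsilon>: "\<epsilon> \<ge> 0"
  defines "Q \<equiv> PiM {1..Suc N} (\<lambda>_. density lborel (\<lambda>x. ennreal (p x)))"
  shows "\<bar>measure Q {\<omega> \<in> space Q. \<omega> 1 \<in> B \<and> real (Suc N) * mfun p t \<le> (\<Sum>i=1..Suc N. \<omega> i)}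
         / measure Q {\<omega> \<in> space Q. real (Suc N) * mfun p t \<le> (\<Sum>i=1..Suc N. \<omega> i)} - measure (tilted p t) B\<bar>
         \<le> \<epsilon> + 8 * C / c * exp (- 2 * real N * \<epsilon>\<^sup>2) / (c / 2) ^ m"
proof -
  let ?P = "density lborel (\<lambda>x. ennreal (p x))" and ?a = "mfun p t"
  define U where "U = mgf p t * (C / \<sigma>) / t"
  define L where "L = mgf p t * (c / \<sigma>) / (2 * t)"
  have ix: "integrable (tilted p t) (\<lambda>x. x)" using integrable_tilted[of "\<lambda>x. x"] integrable_x_exp_p by simp
  have ix2: "integrable (tilted p t) (\<lambda>x. x\<^sup>2)" using integrable_tilted[of "\<lambda>x. x\<^sup>2"] integrable_moment[of 2] by simp
  interpret G: prob_space "tilted p t" by (rule prob_space_tilted)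
  have mean: "(\<integral>x. x \<partial>tilted p t) = ?a" using integral_tilted[of "\<lambda>x. x"] mfun_eq by simp
  have ia: "integrable (tilted p t) (\<lambda>x. (x - ?a)\<^sup>2)" using ix ix2 by (simp add: power2_diff)
  have \<phi>: "mgf p t > 0" by (rule mgf_pos)
  \<comment> \<open>Density at least c/\<sigma> over a length \<sigma>/2 gives mass c/2, on either
    side of the mean.\<close>
  have \<kappa>: "c / 2 \<le> measure (tilted p t) {u..u + \<sigma>/2}" if "?a - \<sigma> \<le> u" "u + \<sigma>/2 \<le> ?a + \<sigma>" for u
  proof -
    have "c / \<sigma> * (u + \<sigma>/2 - u) \<le> measure (tilted p t) {u..u + \<sigma>/2}"
      by (rule measure_tilted_Icc_ge) (use that \<sigma> c lo in \<open>simp_all add: abs_le_iff\<close>)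
    then show ?thesis using \<sigma> by simp
  qed
  have "\<bar>measure Q {\<omega> \<in> space Q. \<omega> 1 \<in> B \<and> real (Suc N) * ?a \<le> (\<Sum>i=1..Suc N. \<omega> i)}
         / measure Q {\<omega> \<in> space Q. real (Suc N) * ?a \<le> (\<Sum>i=1..Suc N. \<omega> i)} - measure (tilted p t) B\<bar>
         \<le> \<epsilon> + 4 * (U / L) * exp (- 2 * real N * \<epsilon>\<^sup>2) / (c / 2) ^ m"
    unfolding Q_def tilted_eq_density
  proof (rule conditioned_coordinate_tilted_bound[where V = V and \<sigma> = \<sigma>], goal_cases)
    case 1 then show ?case by (rule prob_space_p)
  next
    case 2 then show ?case using prob_space_tilted[of t] by (simp add: tilted_eq_density)
  next
    case 3 then show ?case by simp
  next
    case 4 then show ?case by (rule \<phi>)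
  next
    case 5 then show ?case by (rule B)
  next
    case 6 then show ?case using ix by (simp add: tilted_eq_density)
  next
    case 7 then show ?case using mean by (simp add: tilted_eq_density)
  next
    case 8 then show ?case using ia by (simp add: tilted_eq_density)
  next
    case 9 then show ?case using var by (simp add: tilted_eq_density)
  next
    case 10
    then show ?case using \<kappa>[of "?a - \<sigma>"] \<sigma> by (simp add: tilted_eq_density)
  next
    case 11
    have "?a + \<sigma>/2 + \<sigma>/2 = ?a + \<sigma>" by simp
    then show ?case using \<kappa>[of "?a + \<sigma>/2"] \<sigma> by (simp only: tilted_eq_density)
  next
    case 12 then show ?case using c by simp
  next
    case (13 s)
    then show ?case unfolding U_def by (rule emeasure_tail_le) (use t \<phi> C \<sigma> up in auto)
  next
    case 14 then show ?case using \<phi> C \<sigma> t by (simp add: U_def)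
  next
    case (15 s)
    \<comment> \<open>For s within \<sigma> of the mean, [s, s + \<sigma>] stays within 2 \<sigma>
      of it, where the lower density bound holds.\<close>
    then show ?case unfolding L_def
      by (intro emeasure_tail_ge[where \<sigma> = \<sigma>]) (use 15 t \<phi> c \<sigma> lo in \<open>simp_all add: abs_le_iff\<close>)
  next
    case 16 then show ?case using \<phi> c \<sigma> t by (simp add: L_def)
  qed (use \<sigma> V m N \<epsilon> in auto)
  also have "4 * (U / L) = 8 * C / c" using \<phi> \<sigma> t c by (simp add: U_def L_def)
  finally show ?thesis .
qed

text \<open>With an exponent of order sqrt N, the power of \<kappa> costs at most e^(O(sqrt N)),
  while the gain is e^(-2 N \<epsilon>^2). Here \<kappa> is merely positive, so |ln \<kappa>| is
  used as the rate; rounding up accounts for the added 1.\<close>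

lemma exp_decay_beats_power_sqrt:
  fixes \<epsilon> D \<kappa> V :: real
  assumes \<epsilon>: "\<epsilon> > 0" and \<kappa>: "\<kappa> > 0" and V: "V \<ge> 0"
  shows "(\<lambda>N. D * exp (- 2 * real N * \<epsilon>\<^sup>2) / \<kappa> ^ nat \<lceil>sqrt (8 * V * real N)\<rceil>) \<longlonglongrightarrow> 0"
proof (rule tendsto_0_le[where K = "\<bar>D\<bar>"])
  define b where "b = \<bar>ln \<kappa>\<bar>"
  define s where "s = sqrt (8 * V)"
  have "((\<lambda>x::real. exp (- 2 * x * \<epsilon>\<^sup>2 + b * (s * sqrt x + 1))) \<longlongrightarrow> 0) at_top"
  proof (rule filterlim_compose[OF exp_at_bot])
    show "filterlim (\<lambda>x::real. - 2 * x * \<epsilon>\<^sup>2 + b * (s * sqrt x + 1)) at_bot at_top"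
      using \<epsilon> by real_asymp
  qed
  then show "(\<lambda>N. exp (- 2 * real N * \<epsilon>\<^sup>2 + b * (s * sqrt (real N) + 1))) \<longlonglongrightarrow> 0"
    by (rule filterlim_compose) (rule filterlim_real_sequentially)
  show "\<forall>\<^sub>F N in sequentially. norm (D * exp (- 2 * real N * \<epsilon>\<^sup>2) / \<kappa> ^ nat \<lceil>sqrt (8 * V * real N)\<rceil>)
      \<le> norm (exp (- 2 * real N * \<epsilon>\<^sup>2 + b * (s * sqrt (real N) + 1))) * \<bar>D\<bar>"
  proof (intro always_eventually allI)
    fix N :: nat
    let ?m = "nat \<lceil>sqrt (8 * V * real N)\<rceil>"
    have "real ?m \<le> sqrt (8 * V * real N) + 1" using V by (simp add: of_nat_ceiling)
    then have m: "real ?m \<le> s * sqrt (real N) + 1" by (simp add: s_def real_sqrt_mult)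
    have "\<kappa> ^ ?m = exp (real ?m * ln \<kappa>)" using \<kappa> by (simp add: exp_of_nat_mult)
    then have "1 / \<kappa> ^ ?m = exp (real ?m * - ln \<kappa>)" by (simp add: exp_minus field_simps)
    also have "\<dots> \<le> exp (b * (s * sqrt (real N) + 1))"
    proof -
      have "real ?m * - ln \<kappa> \<le> real ?m * b" by (intro mult_left_mono) (auto simp: b_def)
      also have "\<dots> \<le> (s * sqrt (real N) + 1) * b" using m by (intro mult_right_mono) (auto simp: b_def)
      finally show ?thesis by (simp add: mult.commute)
    qed
    finally have "\<bar>D\<bar> * exp (- 2 * real N * \<epsilon>\<^sup>2) * (1 / \<kappa> ^ ?m) \<le> \<bar>D\<bar> * exp (- 2 * real N * \<epsilon>\<^sup>2) * exp (b * (s * sqrt (real N) + 1))"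
      by (intro mult_left_mono) auto
    then show "norm (D * exp (- 2 * real N * \<epsilon>\<^sup>2) / \<kappa> ^ ?m) \<le> norm (exp (- 2 * real N * \<epsilon>\<^sup>2 + b * (s * sqrt (real N) + 1))) * \<bar>D\<bar>"
      using \<kappa> unfolding exp_add by (simp add: abs_mult mult_ac)
  qed
qed

text \<open>The narrowing steps are taken out of the N available summands, so their number must not
  exceed N.\<close>

lemma sqrt_bound_eventually_le:
  assumes V: "V \<ge> (0::real)"
  shows "\<forall>\<^sub>F N in sequentially. nat \<lceil>sqrt (8 * V * real N)\<rceil> \<le> N"
  using eventually_ge_at_top[of "nat \<lceil>8 * V\<rceil>"]
proof eventually_elim
  fix N assume "nat \<lceil>8 * V\<rceil> \<le> N"
  then have "8 * V \<le> real N" by linarith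
  then have "8 * V * real N \<le> (real N)\<^sup>2" by (simp add: power2_eq_square mult_right_mono)
  then have "sqrt (8 * V * real N) \<le> real N" by (intro real_le_lsqrt) auto
  then show "nat \<lceil>sqrt (8 * V * real N)\<rceil> \<le> N" by (simp add: nat_le_iff ceiling_le_iff)
qed

text \<open>The event depends only on the joint law of the first n variables, which is a product
  measure by independence. The case \<open>B = UNIV\<close> covers the conditioning event
  itself.\<close>

lemma (in prob_space) prob_iid_eq_PiM:
  fixes X :: "nat \<Rightarrow> 'a \<Rightarrow> real"
  assumes ind: "indep_vars (\<lambda>_. borel) X UNIV"
    and dist: "\<And>i. distributed M lborel (X i) f"
    and B: "B \<in> sets borel" and n: "n \<ge> 1"
  defines "Q \<equiv> PiM {1..n} (\<lambda>_. density lborel f)"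
  shows "prob {\<omega> \<in> space M. X 1 \<omega> \<in> B \<and> b \<le> (\<Sum>i=1..n. X i \<omega>)}
       = measure Q {\<omega> \<in> space Q. \<omega> 1 \<in> B \<and> b \<le> (\<Sum>i=1..n. \<omega> i)}"
proof -
  have rv: "X i \<in> borel_measurable M" for i using ind by (auto simp: indep_vars_def)
  have "indep_vars (\<lambda>_. borel) X {1..n}" by (rule indep_vars_subset[OF ind]) simp
  then have "distr M (PiM {1..n} (\<lambda>_. borel)) (\<lambda>\<omega>. \<lambda>i\<in>{1..n}. X i \<omega>) = PiM {1..n} (\<lambda>i. distr M borel (X i))"
    using n rv by (subst (asm) indep_vars_iff_distr_eq_PiM) auto
  also have "\<dots> = Q"
    unfolding Q_def
  proof (rule PiM_cong)
    fix i
    have "distr M borel (X i) = distr M lborel (X i)" by (rule distr_cong) auto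
    then show "distr M borel (X i) = density lborel f"
      using distributed_distr_eq_density[OF dist[of i]] by simp
  qed simp
  finally have D: "distr M (PiM {1..n} (\<lambda>_. borel)) (\<lambda>\<omega>. \<lambda>i\<in>{1..n}. X i \<omega>) = Q" .
  have meas: "(\<lambda>\<omega>. \<lambda>i\<in>{1..n}. X i \<omega>) \<in> measurable M (PiM {1..n} (\<lambda>_. borel))"
    using rv by (intro measurable_restrict) auto
  have sp: "space Q = space (PiM {1..n} (\<lambda>_. borel :: real measure))" by (subst D[symmetric]) simp
  let ?E = "{\<omega> \<in> space (PiM {1..n} (\<lambda>_. borel)). \<omega> 1 \<in> B \<and> b \<le> (\<Sum>i=1..n. \<omega> i :: real)}"
  have "(\<lambda>\<omega>. \<omega> 1) -` B \<inter> space (PiM {1..n} (\<lambda>_. borel :: real measure)) \<in> sets (PiM {1..n} (\<lambda>_. borel))"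
    using n B by (intro measurable_sets[OF measurable_component_singleton]) auto
  moreover have "{\<omega> \<in> space (PiM {1..n} (\<lambda>_. borel)). b \<le> (\<Sum>i=1..n. \<omega> i :: real)} \<in> sets (PiM {1..n} (\<lambda>_. borel))"
    by measurable
  ultimately have "((\<lambda>\<omega>. \<omega> 1) -` B \<inter> space (PiM {1..n} (\<lambda>_. borel :: real measure))) \<inter>
      {\<omega> \<in> space (PiM {1..n} (\<lambda>_. borel)). b \<le> (\<Sum>i=1..n. \<omega> i :: real)} \<in> sets (PiM {1..n} (\<lambda>_. borel))"
    by (rule sets.Int)
  also have "((\<lambda>\<omega>. \<omega> 1) -` B \<inter> space (PiM {1..n} (\<lambda>_. borel :: real measure))) \<inter>
      {\<omega> \<in> space (PiM {1..n} (\<lambda>_. borel)). b \<le> (\<Sum>i=1..n. \<omega> i :: real)} = ?E" by auto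
  finally have E: "?E \<in> sets (PiM {1..n} (\<lambda>_. borel))" .
  have "measure Q ?E = prob ((\<lambda>\<omega>. \<lambda>i\<in>{1..n}. X i \<omega>) -` ?E \<inter> space M)"
    by (subst D[symmetric], rule measure_distr[OF meas E])
  also have "(\<lambda>\<omega>. \<lambda>i\<in>{1..n}. X i \<omega>) -` ?E \<inter> space M = {\<omega> \<in> space M. X 1 \<omega> \<in> B \<and> b \<le> (\<Sum>i=1..n. X i \<omega>)}"
    using n measurable_space[OF meas] by auto
  finally show ?thesis by (simp only: sp)
qed

text \<open>The lower limit keeps P above some b' > 0, so Q exceeds b'/2 once the difference is
  below b'/2; dividing by Q then costs at most the factor 2/b'.\<close>

lemma relative_error_from_absolute:
  fixes P Q :: "nat \<Rightarrow> real"
  assumes diff: "(\<lambda>n. P n - Q n) \<longlonglongrightarrow> 0" and P: "liminf (\<lambda>n. ereal (P n)) > 0"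
  shows "\<exists>r. r \<longlonglongrightarrow> 0 \<and> (\<forall>\<^sub>F n in sequentially. P n = (1 + r n) * Q n)"
proof -
  obtain b :: ereal where b: "0 < b" "b < liminf (\<lambda>n. ereal (P n))" using dense[OF P] by blast
  obtain b' where b': "b = ereal b'" using b by (cases b) auto
  have "\<forall>\<^sub>F n in sequentially. b < ereal (P n)" by (rule less_LiminfD[OF b(2)])
  then have Pb: "\<forall>\<^sub>F n in sequentially. P n > b'" by (simp add: b')
  have b0: "b' > 0" using b b' by simp
  have "\<forall>\<^sub>F n in sequentially. dist (P n - Q n) 0 < b' / 2"
    using diff b0 by (intro tendstoD) auto
  with Pb have Q: "\<forall>\<^sub>F n in sequentially. Q n > b' / 2"
  proof eventually_elim
    fix n assume "b' < P n" "dist (P n - Q n) 0 < b' / 2"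
    then show "b' / 2 < Q n" unfolding dist_real_def by linarith
  qed
  define r where "r n = (P n - Q n) / Q n" for n
  have "r \<longlonglongrightarrow> 0"
  proof (rule tendsto_0_le[OF diff, where K = "2 / b'"])
    show "\<forall>\<^sub>F n in sequentially. norm (r n) \<le> norm (P n - Q n) * (2 / b')"
      using Q
    proof eventually_elim
      fix n assume n: "Q n > b' / 2"
      have "\<bar>P n - Q n\<bar> / Q n \<le> \<bar>P n - Q n\<bar> / (b' / 2)" using n b0 by (intro divide_left_mono) auto
      then show "norm (r n) \<le> norm (P n - Q n) * (2 / b')" using n b0 by (simp add: r_def)
    qed
  qed
  moreover have "\<forall>\<^sub>F n in sequentially. P n = (1 + r n) * Q n"
    using Q by eventually_elim (use b0 in \<open>auto simp: r_def field_simps\<close>)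
  ultimately show ?thesis by blast
qed

text \<open>By monotonicity, t_n < T would give m(t_n) <= m(T), which fails as soon as m(t_n)
  exceeds m(T).\<close>

lemma (in superexponential_density) saddle_parameter_tends_to_infinity:
  assumes "filterlim (\<lambda>n. mfun p (t n)) at_top F"
  shows "filterlim t at_top F"
  unfolding filterlim_at_top
proof
  fix T
  have "\<forall>\<^sub>F n in F. mfun p T < mfun p (t n)" using assms by (simp add: filterlim_at_top_dense)
  then show "\<forall>\<^sub>F n in F. T \<le> t n" by eventually_elim (metis mfun_mono linorder_not_less nle_le)
qed

text \<open>For a given R, g(x) >= R x holds beyond some y and gives the decay there. On [0, y) the
  bound P suffices, since exp (|R| |y|) outweighs the smallest value that exp (-R x) can
  take.\<close>

lemma superexponential_density_of_exponent:
  fixes p g q :: "real \<Rightarrow> real"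
  assumes M: "prob_space M" and dist: "distributed M lborel Y (\<lambda>x. ennreal (p x))" and c: "c > 0"
    and p: "\<And>x. p x = (if 0 \<le> x then c * exp (- (g x - q x)) else 0)" and P: "\<And>x. p x \<le> P"
    and g: "filterlim (\<lambda>x. g x / x) at_top at_top" and q: "\<forall>\<^sub>F x in at_top. \<bar>q x\<bar> \<le> 1"
  shows "superexponential_density p"
proof
  interpret M: prob_space M by (rule M)
  have nn: "p x \<ge> 0" for x using p c by simp
  show "p x \<ge> 0" for x by (rule nn)
  show "p x = 0" if "x < 0" for x using p that by simp
  have m: "(\<lambda>x. ennreal (p x)) \<in> borel_measurable borel"
    using distributed_borel_measurable[OF dist] by simp
  have "(\<lambda>x. enn2real (ennreal (p x))) \<in> borel_measurable borel" using m by measurable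
  then show meas: "p \<in> borel_measurable borel" using nn by simp
  have "prob_space (distr M lborel Y)"
    using distributed_measurable[OF dist] by (rule M.prob_space_distr)
  then have "prob_space (density lborel (\<lambda>x. ennreal (p x)))"
    using distributed_distr_eq_density[OF dist] by simp
  then have "(\<integral>\<^sup>+x. ennreal (p x) \<partial>lborel) = 1"
    using prob_space.emeasure_space_1 m by (fastforce simp: emeasure_density)
  then show "(\<integral>x. p x \<partial>lborel) = 1"
    using meas nn by (subst integral_eq_nn_integral) auto
  have Pn: "P \<ge> 0" using nn P order_trans by blast
  show "\<exists>C. \<forall>x. p x \<le> C * exp (- R * \<bar>x\<bar>)" for R
  proof -
    have "\<forall>\<^sub>F x in at_top. R \<le> g x / x" using g by (simp add: filterlim_at_top)
    with q eventually_gt_at_top[of 0] have "\<forall>\<^sub>F x in at_top. \<bar>q x\<bar> \<le> 1 \<and> R * x \<le> g x"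
      by eventually_elim (auto simp: pos_le_divide_eq)
    then obtain y where y: "\<And>x. x \<ge> y \<Longrightarrow> \<bar>q x\<bar> \<le> 1 \<and> R * x \<le> g x"
      unfolding eventually_at_top_linorder by blast
    have "p x \<le> (c * exp 1 + P * exp (\<bar>R\<bar> * \<bar>y\<bar>)) * exp (- R * \<bar>x\<bar>)" for x
    proof -
      consider "x < 0" | "0 \<le> x" "x \<ge> y" | "0 \<le> x" "x < y" by linarith
      then have "p x \<le> c * exp 1 * exp (- R * \<bar>x\<bar>) \<or> p x \<le> P * exp (\<bar>R\<bar> * \<bar>y\<bar>) * exp (- R * \<bar>x\<bar>)"
      proof cases
        case 1
        then show ?thesis using p[of x] c by simp
      next
        case 2
        have "- (g x - q x) \<le> 1 + - R * \<bar>x\<bar>" using y[OF 2(2)] 2(1) by (auto simp: abs_le_iff)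
        then have "exp (- (g x - q x)) \<le> exp 1 * exp (- R * \<bar>x\<bar>)" by (simp only: mult_exp_exp exp_le_cancel_iff)
        then show ?thesis using p[of x] 2(1) c by (simp add: mult.assoc)
      next
        case 3
        have "R * \<bar>x\<bar> \<le> \<bar>R\<bar> * \<bar>y\<bar>" using 3 by (intro mult_mono) auto
        then have "1 \<le> exp (\<bar>R\<bar> * \<bar>y\<bar>) * exp (- R * \<bar>x\<bar>)" by (simp add: mult_exp_exp)
        then have "P * 1 \<le> P * (exp (\<bar>R\<bar> * \<bar>y\<bar>) * exp (- R * \<bar>x\<bar>))" using Pn by (intro mult_left_mono) auto
        then show ?thesis using P[of x] by (simp add: mult.assoc)
      qed
      moreover have "0 \<le> c * exp 1 * exp (- R * \<bar>x\<bar>)" "0 \<le> P * exp (\<bar>R\<bar> * \<bar>y\<bar>) * exp (- R * \<bar>x\<bar>)"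
        using c Pn by auto
      ultimately have "p x \<le> c * exp 1 * exp (- R * \<bar>x\<bar>) + P * exp (\<bar>R\<bar> * \<bar>y\<bar>) * exp (- R * \<bar>x\<bar>)" by linarith
      then show ?thesis by (simp add: distrib_right)
    qed
    then show ?thesis by blast
  qed
qed

theorem theorem5p2:
  fixes M :: "'w measure" and X :: "nat \<Rightarrow> 'w \<Rightarrow> real"
    and p g h q :: "real \<Rightarrow> real" and c k \<delta> :: real
    and a t \<epsilon> :: "nat \<Rightarrow> real" and B :: "nat \<Rightarrow> real set"
  assumes M: "prob_space M"
    and indep: "prob_space.indep_vars M (\<lambda>_. borel) X UNIV"
    and distr: "\<And>i. distributed M lborel (X i) (\<lambda>x. ennreal (p x))"
    and c_pos: "c > 0"
    and p_def: "\<And>x. p x = (if 0 \<le> x then c * exp (- (g x - q x)) else 0)"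
    and p_bdd: "\<exists>C. \<forall>x. p x \<le> C"
    and g_pos: "\<And>x. 0 \<le> x \<Longrightarrow> g x > 0"
    and g_deriv: "\<And>x. 0 \<le> x \<Longrightarrow> (g has_real_derivative h x) (at x within {0..})"
    and g_super: "filterlim (\<lambda>x. g x / x) at_top at_top"
    and q_small: "\<exists>\<theta>>0. \<forall>\<^sub>F x in at_top. \<forall>v. \<bar>v - x\<bar> < \<theta> * x \<longrightarrow> \<bar>q v\<bar> \<le> 1 / sqrt (x * h x)"
    and k_gt: "k > 1"
    and h_R: "in_R (k - 1) h"
    and a_lim: "filterlim a at_top sequentially"
    and t_sol: "\<And>n. mfun p (t n) = a n"
    and cond_i: "(\<lambda>n. (psi h (t n))\<^sup>2 / sqrt (real n * deriv (psi h) (t n))) \<longlonglongrightarrow> 0"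
    and \<delta>_pos: "\<delta> > 0"
    and cond_ii: "liminf (\<lambda>n. ereal (ln (g (a n)) / ln (real n))) > ereal \<delta>"
    and \<epsilon>_pos: "\<And>n. \<epsilon> n > 0"
    and cond_iii: "(\<lambda>n. real n * ln (a n) / (a n powr (k - 2) * (\<epsilon> n)\<^sup>2)) \<longlonglongrightarrow> 0"
    and B_borel: "\<And>n. B n \<in> sets borel"
    and B_liminf: "liminf (\<lambda>n. ereal (cond_prob M (\<lambda>\<omega>. X 1 \<omega> \<in> B n)
                      (\<lambda>\<omega>. (\<Sum>i=1..n. X i \<omega>) \<ge> real n * a n))) > 0"
  shows "\<exists>r :: nat \<Rightarrow> real. r \<longlonglongrightarrow> 0 \<and>
           (\<forall>\<^sub>F n in sequentially.
              cond_prob M (\<lambda>\<omega>. X 1 \<omega> \<in> B n) (\<lambda>\<omega>. (\<Sum>i=1..n. X i \<omega>) \<ge> real n * a n)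
              = (1 + r n) * measure (tilted p (t n)) (B n))"
proof -
  interpret M: prob_space M by (rule M)
  obtain x1 h' where x1: "x1 \<ge> 1" and hpos: "\<And>x. x \<ge> x1 \<Longrightarrow> h x > 0"
    and hd: "\<And>x. x \<ge> x1 \<Longrightarrow> (h has_real_derivative h' x) (at x)"
    and hlo: "\<And>x. x \<ge> x1 \<Longrightarrow> (k - 1) / 2 * (h x / x) \<le> h' x"
    and hup: "\<And>x. x \<ge> x1 \<Longrightarrow> h' x \<le> 2 * (k - 1) * (h x / x)"
    using in_R_derivative_bounds[OF h_R] k_gt by auto
  obtain P where P: "\<And>x. p x \<le> P" using p_bdd by blast
  have q1: "\<forall>\<^sub>F x in at_top. \<bar>q x\<bar> \<le> 1"
  proof -
    obtain \<theta> where \<theta>: "\<theta> > 0" "\<forall>\<^sub>F x in at_top. \<forall>v. \<bar>v - x\<bar> < \<theta> * x \<longrightarrow> \<bar>q v\<bar> \<le> 1 / sqrt (x * h x)"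
      using q_small by blast
    show ?thesis
      using \<theta>(2) eventually_ge_at_top[of x1] eventually_ge_at_top[of "1 / h x1"]
    proof eventually_elim
      fix x assume x: "\<forall>v. \<bar>v - x\<bar> < \<theta> * x \<longrightarrow> \<bar>q v\<bar> \<le> 1 / sqrt (x * h x)" "x1 \<le> x" "1 / h x1 \<le> x"
      \<comment> \<open>Beyond x1 the function h stays above h(x1), so x h(x) >= 1 once x >= 1 /
        h(x1). The smallness condition at v = x then reads |q(x)| <= 1.\<close>
      have h1: "h x1 > 0" using hpos by simp
      have "h x1 * 1 \<le> h x1 * (x / x1) powr ((k - 1) / 2)"
        using x x1 k_gt h1 by (intro mult_left_mono ge_one_powr_ge_zero) auto
      also have "\<dots> \<le> h x"
        by (rule powr_growth_bounds(1)[OF x1 _ _ _ _ x(2), where h' = h']) (use hd hlo hup in auto)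
      finally have "x * h x1 \<le> x * h x" using x x1 by (intro mult_left_mono) auto
      moreover have "1 \<le> x * h x1" using x(3) h1 by (simp add: divide_le_eq)
      ultimately have "1 \<le> sqrt (x * h x)" by simp
      moreover have "\<bar>q x\<bar> \<le> 1 / sqrt (x * h x)" using x(1)[rule_format, of x] x(2) x1 \<theta>(1) by simp
      ultimately show "\<bar>q x\<bar> \<le> 1" by (smt (verit) divide_le_eq_1)
    qed
  qed
  interpret superexponential_density p
    by (rule superexponential_density_of_exponent[OF M distr[of 0] c_pos p_def P g_super q1])
  obtain x2 where x2: "\<And>x. x \<ge> x2 \<Longrightarrow> \<bar>q x\<bar> \<le> 1" using q1 unfolding eventually_at_top_linorder by blast
  define x0 where "x0 = max x1 x2"
  have x0: "x0 \<ge> 1" "x0 \<ge> x1" "x0 \<ge> x2" using x1 by (auto simp: x0_def)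
  have gd: "(g has_real_derivative h x) (at x)" if "x \<ge> x0" for x
  proof -
    have "at x within {0..} = at x" using that x0 by (intro at_within_interior) auto
    then show ?thesis using g_deriv[of x] that x0 by simp
  qed
  obtain C c' \<mu> B' T where env: "C > 0" "c' > 0" "\<mu> > 0" "T \<ge> 1"
    "\<And>t. t \<ge> T \<Longrightarrow> laplace_envelope p C \<mu> c' B' t"
  proof -
    have "k - 1 > 0" and "\<And>x. x \<ge> x0 \<Longrightarrow> h x > 0"
      and "\<And>x. x \<ge> x0 \<Longrightarrow> (h has_real_derivative h' x) (at x)"
      and "\<And>x. x \<ge> x0 \<Longrightarrow> (k - 1) / 2 * (h x / x) \<le> h' x"
      and "\<And>x. x \<ge> x0 \<Longrightarrow> h' x \<le> 2 * (k - 1) * (h x / x)"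
      and "\<And>x. x \<ge> x0 \<Longrightarrow> \<bar>q x\<bar> \<le> 1"
      using k_gt hpos hd hlo hup x2 x0 by auto
    note facts = this
    show ?thesis
      by (rule laplace_envelope_exists[OF x0(1) facts(1-5) gd facts(6) c_pos p_def P that])
  qed
  obtain C2 c2 V T2 where sc: "C2 > 0" "c2 > 0" "V \<ge> 0" "T2 \<ge> 1"
    "\<forall>t\<ge>T2. laplace_envelope p C \<mu> c' B' t \<longrightarrow> tilted_scale p C2 c2 V t"
    by (rule tilted_scale_bounds[OF env(1,2,3) that])
  define Pn where "Pn n = cond_prob M (\<lambda>\<omega>. X 1 \<omega> \<in> B n) (\<lambda>\<omega>. (\<Sum>i=1..n. X i \<omega>) \<ge> real n * a n)" for n
  define Gn where "Gn n = measure (tilted p (t n)) (B n)" for n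
  have t_lim: "filterlim t at_top sequentially"
    by (rule saddle_parameter_tends_to_infinity) (simp add: t_sol a_lim)
  define R where "R \<epsilon> N = 8 * C2 / c2 * exp (- 2 * real N * \<epsilon>\<^sup>2) / (c2 / 2) ^ nat \<lceil>sqrt (8 * V * real N)\<rceil>" for \<epsilon> N
  \<comment> \<open>The index is shifted to n = N + 1 because the last summand is integrated out and
    N counts the summands that enter the frequency.\<close>
  have bound: "\<bar>Pn (Suc N) - Gn (Suc N)\<bar> \<le> \<epsilon> + R \<epsilon> N"
    if \<epsilon>: "\<epsilon> > 0" and N: "N > 0" "nat \<lceil>sqrt (8 * V * real N)\<rceil> \<le> N" and tN: "t (Suc N) \<ge> max T T2" for \<epsilon> N
  proof -
    let ?t = "t (Suc N)" and ?m = "nat \<lceil>sqrt (8 * V * real N)\<rceil>"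
    let ?Q = "PiM {1..Suc N} (\<lambda>_. density lborel (\<lambda>x. ennreal (p x)))"
    have T: "?t \<ge> T" "?t \<ge> T2" "?t \<ge> 1" using tN env(4) by auto
    obtain \<sigma> where \<sigma>: "\<sigma> > 0" "?t * \<sigma> \<ge> 1" "\<And>x. exp (?t * x) * p x \<le> mgf p ?t * (C2 / \<sigma>)"
      "\<And>x. \<bar>x - mfun p ?t\<bar> \<le> 2 * \<sigma> \<Longrightarrow> mgf p ?t * (c2 / \<sigma>) \<le> exp (?t * x) * p x"
      "(\<integral>x. (x - mfun p ?t)\<^sup>2 \<partial>tilted p ?t) \<le> V * \<sigma>\<^sup>2"
      using sc(5)[rule_format, OF T(2) env(5)[OF T(1)]] unfolding tilted_scale_def by blast
    have m: "8 * V * real N \<le> (real ?m)\<^sup>2"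
    proof -
      have "sqrt (8 * V * real N) \<le> real ?m" by linarith
      then have "(sqrt (8 * V * real N))\<^sup>2 \<le> (real ?m)\<^sup>2" using sc(3) by (intro power_mono) auto
      then show ?thesis using sc(3) by simp
    qed
    have am: "mfun p ?t = a (Suc N)" by (rule t_sol)
    have ev: "M.prob {\<omega> \<in> space M. X 1 \<omega> \<in> B' \<and> real (Suc N) * a (Suc N) \<le> (\<Sum>i=1..Suc N. X i \<omega>)}
      = measure ?Q {\<omega> \<in> space ?Q. \<omega> 1 \<in> B' \<and> real (Suc N) * a (Suc N) \<le> (\<Sum>i=1..Suc N. \<omega> i)}"
      if "B' \<in> sets borel" for B'
      by (rule M.prob_iid_eq_PiM[OF indep distr that]) simp
    have "Pn (Suc N) = measure ?Q {\<omega> \<in> space ?Q. \<omega> 1 \<in> B (Suc N) \<and> real (Suc N) * mfun p ?t \<le> (\<Sum>i=1..Suc N. \<omega> i)}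
         / measure ?Q {\<omega> \<in> space ?Q. real (Suc N) * mfun p ?t \<le> (\<Sum>i=1..Suc N. \<omega> i)}"
      unfolding Pn_def cond_prob_def am using ev[OF B_borel[of "Suc N"]] ev[of UNIV] by simp
    then show ?thesis
      unfolding Gn_def R_def
      using conditioned_coordinate_close_to_tilted[OF sc(1-3) _ \<sigma> B_borel[of "Suc N"] N(2) m N(1), of \<epsilon>] T(3) \<epsilon>
      by simp
  qed
  have "(\<lambda>n. Pn n - Gn n) \<longlonglongrightarrow> 0"
  proof (rule tendstoI)
    fix e :: real assume e: "e > 0"
    \<comment> \<open>Half of e is the permitted deviation of the frequency, fixed while N grows;
      the other half bounds the remainder R.\<close>
    have "R (e / 2) \<longlonglongrightarrow> 0"
      unfolding R_def using e sc by (intro exp_decay_beats_power_sqrt) auto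
    then have "\<forall>\<^sub>F N in sequentially. dist (R (e / 2) N) 0 < e / 2"
      using e by (intro tendstoD) auto
    moreover have "\<forall>\<^sub>F N in sequentially. max T T2 \<le> t (Suc N)"
      using t_lim unfolding filterlim_at_top by (subst eventually_sequentially_Suc) blast
    moreover note sqrt_bound_eventually_le[OF sc(3)] eventually_gt_at_top[of "0::nat"]
    ultimately have "\<forall>\<^sub>F N in sequentially. dist (Pn (Suc N) - Gn (Suc N)) 0 < e"
    proof eventually_elim
      fix N assume N: "dist (R (e / 2) N) 0 < e / 2" "max T T2 \<le> t (Suc N)"
        "nat \<lceil>sqrt (8 * V * real N)\<rceil> \<le> N" "0 < N"
      have "\<bar>Pn (Suc N) - Gn (Suc N)\<bar> \<le> e / 2 + R (e / 2) N" using e N by (intro bound) auto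
      then show "dist (Pn (Suc N) - Gn (Suc N)) 0 < e" using N(1) by (simp add: dist_real_def)
    qed
    then show "\<forall>\<^sub>F n in sequentially. dist (Pn n - Gn n) 0 < e"
      by (rule eventually_sequentially_Suc[THEN iffD1])
  qed
  from relative_error_from_absolute[OF this] B_liminf show ?thesis
    unfolding Pn_def Gn_def by blast
qed

end
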